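(* For $m=2$, $p_2^{\mathrm{convex}}\ge 2.0186$; more precisely $p_2^{\mathrm{convex}}\ge 2+2/\sqrt{11559}$.
   Context: In $\mathbb{R}^2$: for a non-empty open $\Omega$ with $|\Omega|<\infty$, $\lambda_1(\Omega)=\inf_{\varphi\in H_0^1(\Omega)\setminus\{0\}}\int_\Omega|D\varphi|^2/\int_\Omega\varphi^2$, $v_\Omega$ is the unique solution of $-\Delta v=1$, $v\in H_0^1(\Omega)$, $F_p(\Omega)=\|v_\Omega\|_{L^p(\Omega)}\lambda_1(\Omega)/|\Omega|^{1/p}$, $\mathfrak{F}^{\mathrm{convex}}_p=\sup\{F_p(\Omega):\Omega\text{ open, convex in }\mathbb{R}^2,\ 0<|\Omega|<\infty\}$, and $p_2^{\mathrm{convex}}=\inf\{p\ge1:\mathfrak{F}^{\mathrm{convex}}_p>1\}$. *)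

theory Defs
  imports "HOL-Analysis.Analysis"
begin

type_synonym pt = "real^2"

definition grad :: "(pt \<Rightarrow> real) \<Rightarrow> pt \<Rightarrow> pt" where
  "grad f x = (\<chi> i. frechet_derivative f (at x) (axis i 1))"

definition test_fun :: "pt set \<Rightarrow> (pt \<Rightarrow> real) \<Rightarrow> bool" where
  "test_fun \<Omega> \<phi> \<longleftrightarrow>
     (\<forall>x. \<phi> differentiable at x) \<and> continuous_on UNIV (grad \<phi>) \<and>
     compact (closure {x. \<phi> x \<noteq> 0}) \<and> closure {x. \<phi> x \<noteq> 0} \<subseteq> \<Omega>"

text \<open>v belongs to H_0^1(Omega) (extended by zero to the plane) with weak gradient g:
  v is the H^1-limit of test functions.\<close>
definition in_H01 :: "pt set \<Rightarrow> (pt \<Rightarrow> real) \<Rightarrow> (pt \<Rightarrow> pt) \<Rightarrow> bool" where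
  "in_H01 \<Omega> v g \<longleftrightarrow>
     v \<in> borel_measurable lborel \<and> g \<in> borel_measurable lborel \<and>
     (\<exists>\<phi> :: nat \<Rightarrow> pt \<Rightarrow> real. (\<forall>n. test_fun \<Omega> (\<phi> n)) \<and>
        ((\<lambda>n. \<integral>\<^sup>+ x. ennreal ((\<phi> n x - v x)\<^sup>2) \<partial>lborel) \<longlonglongrightarrow> 0) \<and>
        ((\<lambda>n. \<integral>\<^sup>+ x. ennreal ((norm (grad (\<phi> n) x - g x))\<^sup>2) \<partial>lborel) \<longlonglongrightarrow> 0))"

definition lambda1 :: "pt set \<Rightarrow> real" where
  "lambda1 \<Omega> = Inf {(\<integral>x. (norm (g x))\<^sup>2 \<partial>lborel) / (\<integral>x. (v x)\<^sup>2 \<partial>lborel) | v g.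
                      in_H01 \<Omega> v g \<and> (\<integral>\<^sup>+ x. ennreal ((v x)\<^sup>2) \<partial>lborel) \<noteq> 0}"

definition torsion_sol :: "pt set \<Rightarrow> (pt \<Rightarrow> real) \<Rightarrow> (pt \<Rightarrow> pt) \<Rightarrow> bool" where
  "torsion_sol \<Omega> v g \<longleftrightarrow> in_H01 \<Omega> v g \<and>
     (\<forall>\<phi>. test_fun \<Omega> \<phi> \<longrightarrow> (\<integral>x. g x \<bullet> grad \<phi> x \<partial>lborel) = (\<integral>x. \<phi> x \<partial>lborel))"

text \<open>L^p norm of the torsion function (independent of the a.e.-representative).\<close>
definition torsion_Lp :: "real \<Rightarrow> pt set \<Rightarrow> real" where
  "torsion_Lp p \<Omega> = (THE t. \<exists>v g. torsion_sol \<Omega> v g \<and>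
                        t = (\<integral>x. \<bar>v x\<bar> powr p \<partial>lborel) powr (1 / p))"

definition F_p :: "real \<Rightarrow> pt set \<Rightarrow> real" where
  "F_p p \<Omega> = torsion_Lp p \<Omega> * lambda1 \<Omega> / (measure lborel \<Omega>) powr (1 / p)"

definition F_convex :: "real \<Rightarrow> ereal" where
  "F_convex p = Sup {ereal (F_p p \<Omega>) | \<Omega>. open \<Omega> \<and> convex \<Omega> \<and>
                      0 < emeasure lborel \<Omega> \<and> emeasure lborel \<Omega> < \<infinity>}"

definition p2_convex :: ereal where
  "p2_convex = Inf {ereal p | p. p \<ge> 1 \<and> F_convex p > 1}"

end

theory Submission
  imports Defs
begin

text \<open>
  Write \<open>\<lambda>\<close> for the first eigenvalue, \<open>v\<close> for the torsion function, \<open>A\<close> for the area, \<open>N = \<integral> v\<^sup>2\<close> and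
  \<open>T = \<integral> v = \<integral> \<bar>Dv\<bar>\<^sup>2\<close>. From \<open>\<lambda> N \<le> T\<close> and \<open>T\<^sup>2 \<le> A N\<close> one gets \<open>\<lambda>\<^sup>2 N \<le> A\<close>, the bound for \<open>p = 2\<close>, and
  convexity makes it strict by a definite factor: if it were almost an equality, \<open>v\<close> would be almost
  constant in the quadratic mean. But \<open>v\<close> vanishes on the boundary of a set lying in a strip of width
  \<open>W\<close>, and integration by parts against the affine coordinate \<open>y\<close> across the strip bounds the variance
  of \<open>v\<close> from below in terms of \<open>T\<close> and \<open>W\<close>. The two scales match because a convex set contained in
  a suitable strip of width \<open>W\<close> contains a disc of radius \<open>W/4\<close>, whence \<open>\<lambda> W\<^sup>2 \<le> 500/3\<close>. The result is
  \<open>\<lambda>\<^sup>2 N \<le> 0.997 A\<close>.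

  On the other hand \<open>\<lambda> \<integral> v\<^sup>3 \<le> 9/8 N\<close>. For \<open>2 \<le> p \<le> 3\<close> the inequality
  \<open>t\<^sup>p \<le> (3 - p) t\<^sup>2 + (p - 2) t\<^sup>3\<close> at \<open>t = \<lambda> v\<close> then gives \<open>\<integral> (\<lambda> v)\<^sup>p \<le> (1 + (p - 2) / 8) \<lambda>\<^sup>2 N\<close>, which is at most
  \<open>A\<close> for \<open>p \<le> 2.019\<close>. No regularity of \<open>v\<close> is used: all inequalities are proved for test
  functions and passed to the limit.
\<close>

section \<open>Square-integrable functions\<close>

text \<open>Values lie in an arbitrary Euclidean space so that the same lemmas serve functions and
  their gradients.\<close>

definition L2 :: "'a measure \<Rightarrow> ('a \<Rightarrow> 'b::euclidean_space) \<Rightarrow> bool" where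
  "L2 M u \<longleftrightarrow> u \<in> borel_measurable M \<and> integrable M (\<lambda>x. (norm (u x))\<^sup>2)"

lemma L2_measurable: "L2 M u \<Longrightarrow> u \<in> borel_measurable M"
  and L2_integrable_norm: "L2 M u \<Longrightarrow> integrable M (\<lambda>x. (norm (u x))\<^sup>2)"
  by (auto simp: L2_def)

lemma L2_add:
  assumes "L2 M u" "L2 M w"
  shows "L2 M (\<lambda>x. u x + w x)"
  unfolding L2_def
proof
  have [measurable]: "u \<in> borel_measurable M" "w \<in> borel_measurable M"
    using assms by (auto simp: L2_def)
  show "(\<lambda>x. u x + w x) \<in> borel_measurable M" by measurable
  have "integrable M (\<lambda>x. 2 * (norm (u x))\<^sup>2 + 2 * (norm (w x))\<^sup>2)"
    using assms by (auto simp: L2_def)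
  then show "integrable M (\<lambda>x. (norm (u x + w x))\<^sup>2)"
  proof (rule Bochner_Integration.integrable_bound)
    show "AE x in M. norm ((norm (u x + w x))\<^sup>2) \<le> norm (2 * (norm (u x))\<^sup>2 + 2 * (norm (w x))\<^sup>2)"
    proof (intro AE_I2)
      fix x
      have "(norm (u x + w x))\<^sup>2 \<le> (norm (u x) + norm (w x))\<^sup>2"
        by (intro power_mono norm_triangle_ineq) auto
      also have "\<dots> \<le> 2 * (norm (u x))\<^sup>2 + 2 * (norm (w x))\<^sup>2"
        using sum_squares_bound[of "norm (u x)" "norm (w x)"] by (simp add: power2_sum)
      finally show "norm ((norm (u x + w x))\<^sup>2) \<le> norm (2 * (norm (u x))\<^sup>2 + 2 * (norm (w x))\<^sup>2)"
        by simp
    qed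
  qed measurable
qed

lemma L2_scaleR:
  assumes "L2 M u"
  shows "L2 M (\<lambda>x. c *\<^sub>R u x)"
  using assms by (auto simp: L2_def power_mult_distrib)

lemma L2_diff:
  assumes "L2 M u" "L2 M w"
  shows "L2 M (\<lambda>x. u x - w x)"
  using L2_add[OF assms(1) L2_scaleR[OF assms(2), of "-1"]] by simp

lemma L2_inner_integrable:
  assumes "L2 M u" "L2 M w"
  shows "integrable M (\<lambda>x. u x \<bullet> w x)"
proof (rule Bochner_Integration.integrable_bound)
  show "integrable M (\<lambda>x. (norm (u x))\<^sup>2 + (norm (w x))\<^sup>2)"
    using assms by (auto simp: L2_def)
  show "(\<lambda>x. u x \<bullet> w x) \<in> borel_measurable M"
    using assms by (auto simp: L2_def)
  show "AE x in M. norm (u x \<bullet> w x) \<le> norm ((norm (u x))\<^sup>2 + (norm (w x))\<^sup>2)"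
  proof (intro AE_I2)
    fix x
    have "\<bar>u x \<bullet> w x\<bar> \<le> norm (u x) * norm (w x)" by (rule Cauchy_Schwarz_ineq2)
    also have "\<dots> \<le> (norm (u x))\<^sup>2 + (norm (w x))\<^sup>2"
      using sum_squares_bound[of "norm (u x)" "norm (w x)"]
        mult_nonneg_nonneg[OF norm_ge_zero[of "u x"] norm_ge_zero[of "w x"]] by (simp only: mult.assoc)
    finally show "norm (u x \<bullet> w x) \<le> norm ((norm (u x))\<^sup>2 + (norm (w x))\<^sup>2)" by simp
  qed
qed

text \<open>The free parameter \<open>s\<close> serves twice: optimising it gives the Cauchy-Schwarz
  inequality, while \<open>s = -1\<close> and \<open>s = 1\<close> give the expansions of a sum and
  of a difference.\<close>

lemma L2_norm_diff_expand:
  assumes "L2 M u" "L2 M w"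
  shows "(\<integral>x. (norm (u x - s *\<^sub>R w x))\<^sup>2 \<partial>M) =
         (\<integral>x. (norm (u x))\<^sup>2 \<partial>M) - 2 * s * (\<integral>x. u x \<bullet> w x \<partial>M) + s\<^sup>2 * (\<integral>x. (norm (w x))\<^sup>2 \<partial>M)"
proof -
  have "(norm (u x - s *\<^sub>R w x))\<^sup>2 = (norm (u x))\<^sup>2 - (2 * s) * (u x \<bullet> w x) + s\<^sup>2 * (norm (w x))\<^sup>2" for x
    unfolding power2_norm_eq_inner by (simp add: inner_diff inner_commute power2_eq_square algebra_simps)
  then show ?thesis
    using assms L2_inner_integrable[OF assms] by (simp add: L2_def)
qed

text \<open>A nonnegative quadratic polynomial in \<open>s\<close> is evaluated at its minimum
  \<open>b / c\<close>; the degenerate case \<open>c = 0\<close> is treated apart.\<close>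

lemma L2_Cauchy_Schwarz:
  assumes "L2 M u" "L2 M w"
  shows "(\<integral>x. u x \<bullet> w x \<partial>M)\<^sup>2 \<le> (\<integral>x. (norm (u x))\<^sup>2 \<partial>M) * (\<integral>x. (norm (w x))\<^sup>2 \<partial>M)"
proof -
  define a b c where "a = (\<integral>x. (norm (u x))\<^sup>2 \<partial>M)" and "b = (\<integral>x. u x \<bullet> w x \<partial>M)"
    and "c = (\<integral>x. (norm (w x))\<^sup>2 \<partial>M)"
  have nn: "0 \<le> a - 2 * s * b + s\<^sup>2 * c" for s
    unfolding a_def b_def c_def L2_norm_diff_expand[OF assms, symmetric] by simp
  have "c \<ge> 0" unfolding c_def by simp
  show ?thesis
  proof (cases "c = 0")
    case True
    have "b = 0"
    proof (rule ccontr)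
      assume "b \<noteq> 0"
      \<comment> \<open>At this \<open>s\<close> the remaining affine function
        \<open>a - 2 * s * b\<close> equals -1.\<close>
      with nn[of "(a + 1) / (2 * b)"] True show False by simp
    qed
    with True show ?thesis by (simp add: b_def c_def)
  next
    case False
    with \<open>c \<ge> 0\<close> have "c > 0" by simp
    with nn[of "b / c"] have "b\<^sup>2 \<le> a * c" by (simp add: field_simps power2_eq_square)
    then show ?thesis by (simp add: a_def b_def c_def)
  qed
qed

lemma L2_triangle:
  assumes "L2 M u" "L2 M w"
  shows "sqrt (\<integral>x. (norm (u x + w x))\<^sup>2 \<partial>M) \<le> sqrt (\<integral>x. (norm (u x))\<^sup>2 \<partial>M) + sqrt (\<integral>x. (norm (w x))\<^sup>2 \<partial>M)"
proof (rule real_le_lsqrt)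
  let ?a = "\<integral>x. (norm (u x))\<^sup>2 \<partial>M" and ?b = "\<integral>x. (norm (w x))\<^sup>2 \<partial>M"
  have "(\<integral>x. (norm (u x + w x))\<^sup>2 \<partial>M) = ?a + 2 * (\<integral>x. u x \<bullet> w x \<partial>M) + ?b"
    using L2_norm_diff_expand[OF assms, of "-1"] by simp
  also have "(\<integral>x. u x \<bullet> w x \<partial>M) \<le> sqrt (?a * ?b)"
    using real_sqrt_le_mono[OF L2_Cauchy_Schwarz[OF assms]] by simp
  also have "?a + 2 * sqrt (?a * ?b) + ?b = (sqrt ?a + sqrt ?b)\<^sup>2"
    by (simp add: power2_sum real_sqrt_mult)
  finally show "(\<integral>x. (norm (u x + w x))\<^sup>2 \<partial>M) \<le> (sqrt ?a + sqrt ?b)\<^sup>2" by simp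
qed auto

text \<open>Bridge from the extended nonnegative integrals of \<open>in_H01\<close> to real
  integrals: a finite distance to a single \<open>u n\<close> already makes \<open>v\<close>
  square-integrable.\<close>

lemma L2_limit:
  fixes v :: "'a \<Rightarrow> 'b::euclidean_space"
  assumes v: "v \<in> borel_measurable M" and u: "\<And>n. L2 M (u n)"
    and lim: "(\<lambda>n. \<integral>\<^sup>+ x. ennreal ((norm (u n x - v x))\<^sup>2) \<partial>M) \<longlonglongrightarrow> 0"
  shows "L2 M v" "(\<lambda>n. \<integral>x. (norm (u n x - v x))\<^sup>2 \<partial>M) \<longlonglongrightarrow> 0"
proof -
  have [measurable]: "\<And>n. u n \<in> borel_measurable M" "v \<in> borel_measurable M"
    using u v by (auto simp: L2_def)
  obtain n where n: "(\<integral>\<^sup>+ x. ennreal ((norm (u n x - v x))\<^sup>2) \<partial>M) < 1"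
    using order_tendstoD(2)[OF lim, of 1] by (auto dest: eventually_happens)
  have "L2 M (\<lambda>x. u n x - v x)"
    unfolding L2_def
  proof
    show "integrable M (\<lambda>x. (norm (u n x - v x))\<^sup>2)"
      using less_trans[OF n] by (intro integrableI_nonneg) auto
  qed measurable
  from L2_diff[OF u[of n] this] show L2v: "L2 M v" by simp
  have "(\<integral>\<^sup>+ x. ennreal ((norm (u n x - v x))\<^sup>2) \<partial>M) = ennreal (\<integral>x. (norm (u n x - v x))\<^sup>2 \<partial>M)" for n
    using L2_diff[OF u[of n] L2v] by (intro nn_integral_eq_integral) (auto simp: L2_def)
  with lim have "(\<lambda>n. ennreal (\<integral>x. (norm (u n x - v x))\<^sup>2 \<partial>M)) \<longlonglongrightarrow> ennreal 0" by simp
  then show "(\<lambda>n. \<integral>x. (norm (u n x - v x))\<^sup>2 \<partial>M) \<longlonglongrightarrow> 0"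
    by (subst (asm) tendsto_ennreal_iff) auto
qed

lemma L2_tendsto_inner_zero:
  assumes "\<And>n. L2 M (u n)" "\<And>n. L2 M (w n)"
    and lim: "(\<lambda>n. \<integral>x. (norm (u n x))\<^sup>2 \<partial>M) \<longlonglongrightarrow> 0"
    and bd: "(\<lambda>n. \<integral>x. (norm (w n x))\<^sup>2 \<partial>M) \<longlonglongrightarrow> b"
  shows "(\<lambda>n. \<integral>x. u n x \<bullet> w n x \<partial>M) \<longlonglongrightarrow> 0"
proof -
  have "(\<lambda>n. (\<integral>x. (norm (u n x))\<^sup>2 \<partial>M) * (\<integral>x. (norm (w n x))\<^sup>2 \<partial>M)) \<longlonglongrightarrow> 0"
    using tendsto_mult[OF lim bd] by simp
  then have "(\<lambda>n. (\<integral>x. u n x \<bullet> w n x \<partial>M)\<^sup>2) \<longlonglongrightarrow> 0"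
  proof (rule tendsto_sandwich[OF _ _ tendsto_const, rotated 2])
    show "\<forall>\<^sub>F n in sequentially. (\<integral>x. u n x \<bullet> w n x \<partial>M)\<^sup>2 \<le>
        (\<integral>x. (norm (u n x))\<^sup>2 \<partial>M) * (\<integral>x. (norm (w n x))\<^sup>2 \<partial>M)"
      by (intro always_eventually allI L2_Cauchy_Schwarz assms)
  qed simp
  then show ?thesis by simp
qed

text \<open>Expanding around the limits leaves three error terms, each of which has a factor tending
  to 0 and a factor bounded in norm.\<close>

lemma L2_tendsto_inner:
  assumes u: "\<And>n. L2 M (u n)" "L2 M u'" "(\<lambda>n. \<integral>x. (norm (u n x - u' x))\<^sup>2 \<partial>M) \<longlonglongrightarrow> 0"
    and w: "\<And>n. L2 M (w n)" "L2 M w'" "(\<lambda>n. \<integral>x. (norm (w n x - w' x))\<^sup>2 \<partial>M) \<longlonglongrightarrow> 0"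
  shows "(\<lambda>n. \<integral>x. u n x \<bullet> w n x \<partial>M) \<longlonglongrightarrow> (\<integral>x. u' x \<bullet> w' x \<partial>M)"
proof -
  have du: "L2 M (\<lambda>x. u n x - u' x)" and dw: "L2 M (\<lambda>x. w n x - w' x)" for n
    by (rule L2_diff u w)+
  have "(\<integral>x. u n x \<bullet> w n x \<partial>M) = (\<integral>x. (u n x - u' x) \<bullet> (w n x - w' x) \<partial>M) +
          (\<integral>x. (u n x - u' x) \<bullet> w' x \<partial>M) + (\<integral>x. (w n x - w' x) \<bullet> u' x \<partial>M) + (\<integral>x. u' x \<bullet> w' x \<partial>M)" for n
  proof -
    have "(\<integral>x. u n x \<bullet> w n x \<partial>M) = (\<integral>x. (u n x - u' x) \<bullet> (w n x - w' x) +
          (u n x - u' x) \<bullet> w' x + (w n x - w' x) \<bullet> u' x + u' x \<bullet> w' x \<partial>M)"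
      by (intro Bochner_Integration.integral_cong refl) (simp add: inner_diff inner_commute)
    also have "\<dots> = (\<integral>x. (u n x - u' x) \<bullet> (w n x - w' x) \<partial>M) +
          (\<integral>x. (u n x - u' x) \<bullet> w' x \<partial>M) + (\<integral>x. (w n x - w' x) \<bullet> u' x \<partial>M) + (\<integral>x. u' x \<bullet> w' x \<partial>M)"
      using L2_inner_integrable[OF du dw] L2_inner_integrable[OF du w(2)]
        L2_inner_integrable[OF dw u(2)] L2_inner_integrable[OF u(2) w(2)] by simp
    finally show ?thesis .
  qed
  moreover have "(\<lambda>n. (\<integral>x. (u n x - u' x) \<bullet> (w n x - w' x) \<partial>M) +
          (\<integral>x. (u n x - u' x) \<bullet> w' x \<partial>M) + (\<integral>x. (w n x - w' x) \<bullet> u' x \<partial>M) + (\<integral>x. u' x \<bullet> w' x \<partial>M))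
      \<longlonglongrightarrow> 0 + 0 + 0 + (\<integral>x. u' x \<bullet> w' x \<partial>M)"
    by (intro tendsto_add tendsto_const L2_tendsto_inner_zero[OF du dw u(3) w(3)]
        L2_tendsto_inner_zero[OF du w(2) u(3) tendsto_const] L2_tendsto_inner_zero[OF dw u(2) w(3) tendsto_const])
  ultimately show ?thesis by simp
qed

lemma L2_tendsto_norm:
  assumes u: "\<And>n. L2 M (u n)" "L2 M u'" "(\<lambda>n. \<integral>x. (norm (u n x - u' x))\<^sup>2 \<partial>M) \<longlonglongrightarrow> 0"
  shows "(\<lambda>n. \<integral>x. (norm (u n x))\<^sup>2 \<partial>M) \<longlonglongrightarrow> (\<integral>x. (norm (u' x))\<^sup>2 \<partial>M)"
  using L2_tendsto_inner[OF u u] by (simp add: power2_norm_eq_inner)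

lemma L2_tendsto_norm_diff:
  assumes u: "\<And>n. L2 M (u n)" "L2 M u'" "(\<lambda>n. \<integral>x. (norm (u n x - u' x))\<^sup>2 \<partial>M) \<longlonglongrightarrow> 0"
    and w: "\<And>n. L2 M (w n)" "L2 M w'" "(\<lambda>n. \<integral>x. (norm (w n x - w' x))\<^sup>2 \<partial>M) \<longlonglongrightarrow> 0"
  shows "(\<lambda>n. \<integral>x. (norm (u n x - w n x))\<^sup>2 \<partial>M) \<longlonglongrightarrow> (\<integral>x. (norm (u' x - w' x))\<^sup>2 \<partial>M)"
proof -
  have "(\<lambda>n. (\<integral>x. (norm (u n x))\<^sup>2 \<partial>M) - 2 * 1 * (\<integral>x. u n x \<bullet> w n x \<partial>M) + 1\<^sup>2 * (\<integral>x. (norm (w n x))\<^sup>2 \<partial>M))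
      \<longlonglongrightarrow> (\<integral>x. (norm (u' x))\<^sup>2 \<partial>M) - 2 * 1 * (\<integral>x. u' x \<bullet> w' x \<partial>M) + 1\<^sup>2 * (\<integral>x. (norm (w' x))\<^sup>2 \<partial>M)"
    by (intro tendsto_intros L2_tendsto_norm[OF u] L2_tendsto_norm[OF w] L2_tendsto_inner[OF u w])
  then show ?thesis
    unfolding L2_norm_diff_expand[OF u(1) w(1), symmetric] L2_norm_diff_expand[OF u(2) w(2), symmetric] by simp
qed

text \<open>Fatou's lemma in the form used for all almost everywhere limits below: an upper bound on
  the integrals survives, with its own limit.\<close>

lemma nn_integral_limit_le:
  fixes u :: "nat \<Rightarrow> 'a \<Rightarrow> real"
  assumes [measurable]: "\<And>n. u n \<in> borel_measurable M" "v \<in> borel_measurable M"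
    and lim: "AE x in M. (\<lambda>n. u n x) \<longlonglongrightarrow> v x"
    and le: "\<And>n. (\<integral>\<^sup>+ x. ennreal (u n x) \<partial>M) \<le> ennreal (b n)" and b: "b \<longlonglongrightarrow> b'"
  shows "(\<integral>\<^sup>+ x. ennreal (v x) \<partial>M) \<le> ennreal b'"
proof -
  have "(\<integral>\<^sup>+ x. ennreal (v x) \<partial>M) = (\<integral>\<^sup>+ x. liminf (\<lambda>n. ennreal (u n x)) \<partial>M)"
  proof (rule nn_integral_cong_AE, use lim in eventually_elim)
    case (elim x)
    then have "(\<lambda>n. ennreal (u n x)) \<longlonglongrightarrow> ennreal (v x)" by (rule tendsto_ennrealI)
    from lim_imp_Liminf[OF _ this] show ?case by simp
  qed
  also have "\<dots> \<le> liminf (\<lambda>n. \<integral>\<^sup>+ x. ennreal (u n x) \<partial>M)"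
    by (rule nn_integral_liminf) auto
  also have "\<dots> \<le> liminf (\<lambda>n. ennreal (b n))"
    by (intro Liminf_mono always_eventually allI le)
  also have "\<dots> = ennreal b'"
    by (rule lim_imp_Liminf) (auto intro!: tendsto_ennrealI b)
  finally show ?thesis .
qed

lemma ennreal_le_suminf:
  shows "ennreal (f n) \<le> (\<Sum>n. ennreal (f n))"
  using sum_le_suminf[OF summableI, of "{n}" "\<lambda>n. ennreal (f n)"] by simp

text \<open>Riesz-Fischer for sequences with geometrically small increments: the telescoping series
  converges almost everywhere, and Fatou's lemma upgrades this to convergence in norm.\<close>

lemma L2_complete:
  fixes u :: "nat \<Rightarrow> 'a \<Rightarrow> 'b::euclidean_space"
  assumes u: "\<And>n. L2 M (u n)"
    and cauchy: "\<And>n. (\<integral>x. (norm (u (Suc n) x - u n x))\<^sup>2 \<partial>M) \<le> C * (1/4) ^ n"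
  shows "\<exists>v. L2 M v \<and> (\<lambda>n. \<integral>\<^sup>+ x. ennreal ((norm (u n x - v x))\<^sup>2) \<partial>M) \<longlonglongrightarrow> 0"
proof -
  have [measurable]: "\<And>n. u n \<in> borel_measurable M" using u by (auto simp: L2_def)
  define d where "d n x = norm (u (Suc n) x - u n x)" for n x
  have [measurable]: "\<And>n. d n \<in> borel_measurable M" unfolding d_def by measurable
  have d0: "d n x \<ge> 0" for n x by (simp add: d_def)
  have dint: "(\<integral>\<^sup>+ x. ennreal ((d n x)\<^sup>2) \<partial>M) \<le> ennreal (C * (1/4) ^ n)" for n
  proof -
    have "(\<integral>\<^sup>+ x. ennreal ((d n x)\<^sup>2) \<partial>M) = ennreal (\<integral>x. (d n x)\<^sup>2 \<partial>M)"
      using L2_diff[OF u[of "Suc n"] u[of n]] unfolding d_def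
      by (intro nn_integral_eq_integral) (auto simp: L2_def)
    also have "\<dots> \<le> ennreal (C * (1/4) ^ n)"
      using cauchy[of n] by (intro ennreal_leI) (simp add: d_def)
    finally show ?thesis .
  qed
  have C: "C \<ge> 0"
    using order_trans[OF integral_nonneg_AE cauchy[of 0]] by simp
  \<comment> \<open>The weight \<open>2 ^ n\<close> spends half of the decay
    \<open>(1/4) ^ n\<close>: the integrals still sum to a geometric series of ratio 1/2, and
    finiteness of the weighted sum at a point makes \<open>d n x\<close> decay geometrically
    there.\<close>
  have "(\<integral>\<^sup>+ x. (\<Sum>n. ennreal (2 ^ n * (d n x)\<^sup>2)) \<partial>M) = (\<Sum>n. \<integral>\<^sup>+ x. ennreal (2 ^ n * (d n x)\<^sup>2) \<partial>M)"
    by (rule nn_integral_suminf) measurable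
  also have "\<dots> \<le> (\<Sum>n. ennreal (C * (1/2) ^ n))"
  proof (intro suminf_le allI)
    fix n
    have "(\<integral>\<^sup>+ x. ennreal (2 ^ n * (d n x)\<^sup>2) \<partial>M) = ennreal (2 ^ n) * (\<integral>\<^sup>+ x. ennreal ((d n x)\<^sup>2) \<partial>M)"
      by (subst nn_integral_cmult[symmetric]) (auto simp: ennreal_mult)
    also have "\<dots> \<le> ennreal (2 ^ n) * ennreal (C * (1/4) ^ n)"
      by (intro mult_left_mono dint) auto
    also have "\<dots> = ennreal (2 ^ n * (C * (1/4) ^ n))"
      using C by (subst ennreal_mult[symmetric]) auto
    also have "2 ^ n * (C * (1/4) ^ n) = C * (1/2) ^ n"
      by (simp add: power_divide power_mult_distrib[symmetric] field_simps)
    finally show "(\<integral>\<^sup>+ x. ennreal (2 ^ n * (d n x)\<^sup>2) \<partial>M) \<le> ennreal (C * (1/2) ^ n)" .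
  qed auto
  also have "\<dots> = ennreal (\<Sum>n. C * (1/2) ^ n)"
    using C by (intro suminf_ennreal2) (auto intro!: summable_mult summable_geometric)
  finally have fin: "(\<integral>\<^sup>+ x. (\<Sum>n. ennreal (2 ^ n * (d n x)\<^sup>2)) \<partial>M) \<noteq> \<infinity>"
    by (auto simp: top_unique)
  have "AE x in M. (\<Sum>n. ennreal (2 ^ n * (d n x)\<^sup>2)) \<noteq> \<infinity>"
    by (rule nn_integral_PInf_AE[OF _ fin]) measurable
  then have conv: "AE x in M. convergent (\<lambda>n. u n x)"
  proof eventually_elim
    case (elim x)
    define S where "S = enn2real (\<Sum>n. ennreal (2 ^ n * (d n x)\<^sup>2))"
    have S: "(\<Sum>n. ennreal (2 ^ n * (d n x)\<^sup>2)) = ennreal S"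
      using elim by (simp add: S_def less_top)
    have bd: "d n x \<le> sqrt S * (1 / sqrt 2) ^ n" for n
    proof -
      have "ennreal (2 ^ n * (d n x)\<^sup>2) \<le> (\<Sum>n. ennreal (2 ^ n * (d n x)\<^sup>2))"
        by (rule ennreal_le_suminf)
      then have "2 ^ n * (d n x)\<^sup>2 \<le> S" unfolding S
        by (subst (asm) ennreal_le_iff) (simp_all add: S_def)
      then have "sqrt (2 ^ n * (d n x)\<^sup>2) \<le> sqrt S" by (rule real_sqrt_le_mono)
      then have "sqrt 2 ^ n * d n x \<le> sqrt S"
        using d0[of n x] by (simp add: real_sqrt_mult real_sqrt_power)
      then show ?thesis
        by (simp add: power_divide pos_le_divide_eq mult.commute)
    qed
    have "summable (\<lambda>n. sqrt S * (1 / sqrt 2) ^ n)"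
      by (intro summable_mult summable_geometric) (simp add: field_simps)
    then have "summable (\<lambda>n. u (Suc n) x - u n x)"
      by (rule summable_comparison_test[rotated]) (use bd in \<open>auto simp: d_def\<close>)
    then have "convergent (\<lambda>n. (\<Sum>k<n. u (Suc k) x - u k x))"
      by (simp add: summable_iff_convergent)
    then have "convergent (\<lambda>n. (u n x - u 0 x) + u 0 x)"
      unfolding sum_lessThan_telescope[of "\<lambda>k. u k x"] by (intro convergent_add convergent_const)
    then show ?case by simp
  qed
  define v where "v x = lim (\<lambda>n. u n x)" for x
  have [measurable]: "v \<in> borel_measurable M" unfolding v_def by measurable
  have lim: "AE x in M. (\<lambda>n. u n x) \<longlonglongrightarrow> v x"
    using conv by eventually_elim (simp add: v_def convergent_LIMSEQ_iff)
  have diff: "sqrt (\<integral>x. (norm (u (n + k) x - u n x))\<^sup>2 \<partial>M) \<le> sqrt C * 2 * (1/2) ^ n" for n k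
  proof -
    \<comment> \<open>The subtracted power is the tail of the geometric series beyond
      \<open>n + k\<close>; keeping it makes the induction close.\<close>
    have "sqrt (\<integral>x. (norm (u (n + k) x - u n x))\<^sup>2 \<partial>M) \<le> sqrt C * 2 * ((1/2) ^ n - (1/2) ^ (n + k))"
    proof (induction k)
      case (Suc k)
      have "sqrt (\<integral>x. (norm (u (Suc (n + k)) x - u (n + k) x))\<^sup>2 \<partial>M) \<le> sqrt (C * (1/4) ^ (n + k))"
        using cauchy[of "n + k"] by simp
      also have "\<dots> = sqrt C * (1/2) ^ (n + k)"
        using real_sqrt_four by (simp add: real_sqrt_mult real_sqrt_power real_sqrt_divide)
      finally show ?case
        using L2_triangle[OF L2_diff[OF u u, of "Suc (n + k)" "n + k"] L2_diff[OF u u, of "n + k" n]] Suc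
        by (simp add: algebra_simps)
    qed simp
    also have "\<dots> \<le> sqrt C * 2 * (1/2) ^ n"
      using C by (intro mult_left_mono) auto
    finally show ?thesis .
  qed
  \<comment> \<open>The second index of the Cauchy estimate is sent to infinity.\<close>
  have le: "(\<integral>\<^sup>+ x. ennreal ((norm (u n x - v x))\<^sup>2) \<partial>M) \<le> ennreal ((sqrt C * 2 * (1/2) ^ n)\<^sup>2)" for n
  proof (rule nn_integral_limit_le[where u = "\<lambda>k x. (norm (u n x - u (n + k) x))\<^sup>2"])
    show "AE x in M. (\<lambda>k. (norm (u n x - u (n + k) x))\<^sup>2) \<longlonglongrightarrow> (norm (u n x - v x))\<^sup>2"
      using lim
    proof eventually_elim
      case (elim x)
      have "(\<lambda>k. u (k + n) x) \<longlonglongrightarrow> v x" by (rule LIMSEQ_ignore_initial_segment[OF elim])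
      then show ?case by (intro tendsto_intros) (simp add: add.commute)
    qed
    fix k
    have "(\<integral>\<^sup>+ x. ennreal ((norm (u n x - u (n + k) x))\<^sup>2) \<partial>M) = ennreal (\<integral>x. (norm (u n x - u (n + k) x))\<^sup>2 \<partial>M)"
      using L2_diff[OF u u, of n "n + k"] by (intro nn_integral_eq_integral) (auto simp: L2_def)
    also have "(\<integral>x. (norm (u n x - u (n + k) x))\<^sup>2 \<partial>M) \<le> (sqrt C * 2 * (1/2) ^ n)\<^sup>2"
      using diff[of n k] by (simp add: norm_minus_commute sqrt_le_D)
    finally show "(\<integral>\<^sup>+ x. ennreal ((norm (u n x - u (n + k) x))\<^sup>2) \<partial>M) \<le> ennreal ((sqrt C * 2 * (1/2) ^ n)\<^sup>2)"
      by (simp add: ennreal_leI)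
  qed auto
  have "(\<lambda>n. ennreal ((sqrt C * 2 * (1/2) ^ n)\<^sup>2)) \<longlonglongrightarrow> ennreal ((sqrt C * 2 * 0)\<^sup>2)"
    by (intro tendsto_ennrealI tendsto_intros LIMSEQ_power_zero) auto
  then have "(\<lambda>n. ennreal ((sqrt C * 2 * (1/2) ^ n)\<^sup>2)) \<longlonglongrightarrow> 0" by simp
  then have lim0: "(\<lambda>n. \<integral>\<^sup>+ x. ennreal ((norm (u n x - v x))\<^sup>2) \<partial>M) \<longlonglongrightarrow> 0"
    by (rule tendsto_sandwich[OF always_eventually always_eventually tendsto_const, rotated 2])
       (simp, use le in blast)
  with L2_limit(1)[OF _ u lim0] show ?thesis by auto
qed

section \<open>Test functions and integration by parts\<close>

lemma has_derivative_grad: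
  assumes "f differentiable at x"
  shows "(f has_derivative (\<lambda>h. grad f x \<bullet> h)) (at x)"
proof -
  have D: "(f has_derivative frechet_derivative f (at x)) (at x)"
    using assms by (simp add: frechet_derivative_works)
  then interpret bounded_linear "frechet_derivative f (at x)" by (rule has_derivative_bounded_linear)
  have "frechet_derivative f (at x) h = grad f x \<bullet> h" for h
  proof -
    have "h = (\<Sum>i\<in>UNIV. h $ i *\<^sub>R axis i 1)"
      by (simp add: basis_expansion flip: scalar_mult_eq_scaleR)
    then have "frechet_derivative f (at x) h = frechet_derivative f (at x) (\<Sum>i\<in>UNIV. h $ i *\<^sub>R axis i 1)"
      by simp
    also have "\<dots> = (\<Sum>i\<in>UNIV. h $ i * frechet_derivative f (at x) (axis i 1))"
      by (simp add: sum scaleR)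
    finally show ?thesis by (simp add: inner_vec_def grad_def mult.commute)
  qed
  then have "frechet_derivative f (at x) = (\<lambda>h. grad f x \<bullet> h)" by (rule ext)
  with D show ?thesis by simp
qed

lemma grad_eq:
  assumes "(f has_derivative (\<lambda>h. G \<bullet> h)) (at x)"
  shows "grad f x = G"
  using frechet_derivative_at[OF assms, symmetric]
  by (simp add: grad_def vec_eq_iff inner_axis)

text \<open>Any compact set off which \<open>f\<close> vanishes may replace the exact support, so
  closures need never be computed.\<close>

lemma test_funI:
  assumes D: "\<And>x. (f has_derivative (\<lambda>h. G x \<bullet> h)) (at x)"
    and "continuous_on UNIV G" and K: "compact K" "K \<subseteq> \<Omega>" "\<And>x. x \<notin> K \<Longrightarrow> f x = 0"
  shows "test_fun \<Omega> f" "grad f = G"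
proof -
  show G: "grad f = G" using grad_eq[OF D] by auto
  have "closure {x. f x \<noteq> 0} \<subseteq> K"
    by (rule closure_minimal) (use K in \<open>auto intro: compact_imp_closed\<close>)
  moreover from this have "compact (closure {x. f x \<noteq> 0})"
    using K(1) by (metis closed_closure compact_Int_closed inf.absorb_iff2)
  ultimately show "test_fun \<Omega> f"
    unfolding test_fun_def G using assms(2) K(2) D by (auto simp: differentiable_def)
qed

lemma test_fun_deriv: "test_fun \<Omega> f \<Longrightarrow> (f has_derivative (\<lambda>h. grad f x \<bullet> h)) (at x)"
  by (rule has_derivative_grad) (simp add: test_fun_def)

lemma test_fun_cont_grad: "test_fun \<Omega> f \<Longrightarrow> continuous_on UNIV (grad f)"
  by (simp add: test_fun_def)

lemma test_fun_cont: "test_fun \<Omega> f \<Longrightarrow> continuous_on UNIV f"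
  by (meson test_fun_deriv has_derivative_continuous continuous_at_imp_continuous_on)

lemma test_fun_support:
  assumes "test_fun \<Omega> f"
  obtains K where "compact K" "K \<subseteq> \<Omega>" "\<And>x. x \<notin> K \<Longrightarrow> f x = 0" "\<And>x. x \<notin> K \<Longrightarrow> grad f x = 0"
proof
  let ?K = "closure {x. f x \<noteq> 0}"
  show "compact ?K" "?K \<subseteq> \<Omega>" using assms by (auto simp: test_fun_def)
  show z: "f x = 0" if "x \<notin> ?K" for x using that closure_subset[of "{x. f x \<noteq> 0}"] by blast
  show "grad f x = 0" if "x \<notin> ?K" for x
  proof (rule grad_eq)
    have "((\<lambda>_. 0) has_derivative (\<lambda>h. 0 \<bullet> h)) (at x)" by simp
    then show "(f has_derivative (\<lambda>h. 0 \<bullet> h)) (at x)"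
    proof (rule has_derivative_transform_within_open)
      show "open (- ?K)" "x \<in> - ?K" using that by (auto simp only: open_Compl closed_closure Compl_iff)
      show "0 = f y" if "y \<in> - ?K" for y using z[of y] that by simp
    qed
  qed
qed

lemma integrable_compact_support:
  fixes f :: "'a::euclidean_space \<Rightarrow> 'b::{banach, second_countable_topology}"
  assumes "compact K" "continuous_on UNIV f" "\<And>x. x \<notin> K \<Longrightarrow> f x = 0"
  shows "integrable lborel f"
proof -
  have "integrable lborel (\<lambda>x. indicator K x *\<^sub>R f x)"
    using assms by (intro borel_integrable_compact) (auto intro: continuous_on_subset)
  moreover have "(\<lambda>x. indicator K x *\<^sub>R f x) = f"
    using assms(3) by (auto simp: fun_eq_iff indicator_def)
  ultimately show ?thesis by simp
qed

text \<open>The integrand inherits compact support from \<open>f\<close> and \<open>grad f\<close>,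
  because \<open>F\<close> vanishes when both of its last arguments do.\<close>

lemma test_fun_integrable:
  fixes F :: "pt \<Rightarrow> real \<Rightarrow> pt \<Rightarrow> 'b::{banach, second_countable_topology}"
  assumes "test_fun \<Omega> f" "continuous_on UNIV (\<lambda>x. F x (f x) (grad f x))" "\<And>x. F x 0 0 = 0"
  shows "integrable lborel (\<lambda>x. F x (f x) (grad f x))"
proof -
  obtain K where "compact K" "\<And>x. x \<notin> K \<Longrightarrow> f x = 0" "\<And>x. x \<notin> K \<Longrightarrow> grad f x = 0"
    using test_fun_support[OF assms(1)] by metis
  then show ?thesis using assms by (intro integrable_compact_support[of K]) auto
qed

lemma test_fun_L2: "test_fun \<Omega> f \<Longrightarrow> L2 lborel f"
  unfolding L2_def
  using test_fun_integrable[of \<Omega> f "\<lambda>x a b. (norm a)\<^sup>2", OF _ continuous_on_power[OF continuous_on_norm[OF test_fun_cont]]]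
  by (auto intro!: borel_measurable_continuous_onI intro: test_fun_cont)

lemma test_fun_grad_L2: "test_fun \<Omega> f \<Longrightarrow> L2 lborel (grad f)"
  unfolding L2_def
  using test_fun_integrable[of \<Omega> f "\<lambda>x a b. (norm b)\<^sup>2", OF _ continuous_on_power[OF continuous_on_norm[OF test_fun_cont_grad]]]
  by (auto intro!: borel_measurable_continuous_onI intro: test_fun_cont_grad)

lemma test_fun_integrable_self: "test_fun \<Omega> f \<Longrightarrow> integrable lborel f"
  using test_fun_integrable[of \<Omega> f "\<lambda>x a b. a"] by (auto intro: test_fun_cont)

lemma test_fun_add:
  assumes "test_fun \<Omega> f" "test_fun \<Omega> g"
  shows "test_fun \<Omega> (\<lambda>x. f x + g x)" "grad (\<lambda>x. f x + g x) = (\<lambda>x. grad f x + grad g x)"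
proof -
  obtain K where K: "compact K" "K \<subseteq> \<Omega>" "\<And>x. x \<notin> K \<Longrightarrow> f x = 0"
    using test_fun_support[OF assms(1)] by metis
  obtain L where L: "compact L" "L \<subseteq> \<Omega>" "\<And>x. x \<notin> L \<Longrightarrow> g x = 0"
    using test_fun_support[OF assms(2)] by metis
  have D: "((\<lambda>x. f x + g x) has_derivative (\<lambda>h. (grad f x + grad g x) \<bullet> h)) (at x)" for x
    using has_derivative_add[OF test_fun_deriv[OF assms(1)] test_fun_deriv[OF assms(2)]]
    by (simp add: inner_add_left)
  have C: "continuous_on UNIV (\<lambda>x. grad f x + grad g x)"
    by (intro continuous_intros test_fun_cont_grad[OF assms(1)] test_fun_cont_grad[OF assms(2)])
  have KL: "compact (K \<union> L)" "K \<union> L \<subseteq> \<Omega>" "\<And>x. x \<notin> K \<union> L \<Longrightarrow> f x + g x = 0"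
    using K L by auto
  show "test_fun \<Omega> (\<lambda>x. f x + g x)" "grad (\<lambda>x. f x + g x) = (\<lambda>x. grad f x + grad g x)"
    using test_funI[OF D C KL] by blast+
qed

text \<open>The condition \<open>s 0 = 0\<close> preserves the compact support; the chain rule gives
  the rest.\<close>

lemma test_fun_compose:
  assumes f: "test_fun \<Omega> f" and d: "\<And>t. (s has_real_derivative s' t) (at t)"
    and c: "continuous_on UNIV s'" and "s 0 = 0"
  shows "test_fun \<Omega> (\<lambda>x. s (f x))" "grad (\<lambda>x. s (f x)) = (\<lambda>x. s' (f x) *\<^sub>R grad f x)"
proof -
  obtain K where K: "compact K" "K \<subseteq> \<Omega>" "\<And>x. x \<notin> K \<Longrightarrow> f x = 0"
    using test_fun_support[OF f] by metis
  have D: "((\<lambda>x. s (f x)) has_derivative (\<lambda>h. (s' (f x) *\<^sub>R grad f x) \<bullet> h)) (at x)" for x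
    using has_derivative_compose[OF test_fun_deriv[OF f] d[unfolded has_field_derivative_def]] by simp
  have C: "continuous_on UNIV (\<lambda>x. s' (f x) *\<^sub>R grad f x)"
    by (intro continuous_intros test_fun_cont_grad[OF f] continuous_on_compose2[OF c test_fun_cont[OF f]]) auto
  have z: "s (f x) = 0" if "x \<notin> K" for x using that K(3) assms(4) by simp
  show "test_fun \<Omega> (\<lambda>x. s (f x))" "grad (\<lambda>x. s (f x)) = (\<lambda>x. s' (f x) *\<^sub>R grad f x)"
    using test_funI[OF D C K(1,2) z] by blast+
qed

lemma test_fun_scale:
  assumes "test_fun \<Omega> f"
  shows "test_fun \<Omega> (\<lambda>x. c * f x)" "grad (\<lambda>x. c * f x) = (\<lambda>x. c *\<^sub>R grad f x)"
  using test_fun_compose[OF assms, of "\<lambda>t. c * t" "\<lambda>_. c"]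
  by (auto intro!: derivative_eq_intros)

lemma test_fun_diff:
  assumes "test_fun \<Omega> f" "test_fun \<Omega> g"
  shows "test_fun \<Omega> (\<lambda>x. f x - g x)" "grad (\<lambda>x. f x - g x) = (\<lambda>x. grad f x - grad g x)"
  using test_fun_add[OF assms(1) test_fun_scale(1)[OF assms(2), of "-1"]] test_fun_scale(2)[OF assms(2), of "-1"]
  by auto

section \<open>Integration by parts against affine functions\<close>

lemma integral_translation:
  fixes f :: "'a::euclidean_space \<Rightarrow> real"
  assumes [measurable]: "f \<in> borel_measurable borel"
  shows "(\<integral>x. f (a + x) \<partial>lborel) = (\<integral>x. f x \<partial>lborel)"
proof -
  have "(\<integral>x. f x \<partial>lborel) = (\<integral>x. f x \<partial>distr lborel borel ((+) a))"
    by (simp add: lborel_distr_plus)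
  also have "\<dots> = (\<integral>x. f (a + x) \<partial>lborel)"
    by (rule integral_distr) auto
  finally show ?thesis by simp
qed

text \<open>Difference quotients integrate to 0 by translation invariance. They are dominated by a
  Lipschitz bound on a fixed ball, so the derivative integrates to 0 as well.\<close>

lemma integral_directional_derivative:
  assumes f: "test_fun \<Omega> f"
  shows "(\<integral>x. grad f x \<bullet> a \<partial>lborel) = 0"
proof -
  obtain K where K: "compact K" "K \<subseteq> \<Omega>" "\<And>x. x \<notin> K \<Longrightarrow> f x = 0" "\<And>x. x \<notin> K \<Longrightarrow> grad f x = 0"
    using test_fun_support[OF f] by metis
  obtain B where B: "\<And>x. norm (grad f x) \<le> B" "B \<ge> 0"
  proof -
    have "bounded (grad f ` K)"
      by (intro compact_imp_bounded compact_continuous_image continuous_on_subset[OF test_fun_cont_grad[OF f]] K) auto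
    then obtain B where "B > 0" "\<And>x. x \<in> K \<Longrightarrow> norm (grad f x) \<le> B" by (auto simp: bounded_pos)
    then have "norm (grad f x) \<le> B" for x using K(4)[of x] by (cases "x \<in> K") auto
    then show ?thesis using \<open>B > 0\<close> by (intro that[of B]) auto
  qed
  have lip: "\<bar>f y - f x\<bar> \<le> B * norm (y - x)" for x y
  proof -
    have "norm (f y - f x) \<le> B * norm (y - x)"
    proof (rule differentiable_bound[of UNIV f "\<lambda>x h. grad f x \<bullet> h"])
      show "onorm (\<lambda>h. grad f x \<bullet> h) \<le> B" for x
      proof (rule onorm_le)
        fix h
        have "\<bar>grad f x \<bullet> h\<bar> \<le> norm (grad f x) * norm h" by (rule Cauchy_Schwarz_ineq2)
        also have "\<dots> \<le> B * norm h" by (intro mult_right_mono B) auto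
        finally show "norm (grad f x \<bullet> h) \<le> B * norm h" by simp
      qed
    qed (auto intro: test_fun_deriv[OF f])
    then show ?thesis by simp
  qed
  define h where "h n = 1 / real (Suc n)" for n
  have h: "0 < h n" "h n \<le> 1" for n by (auto simp: h_def)
  have h0: "h \<longlonglongrightarrow> 0" unfolding h_def by (rule LIMSEQ_Suc[OF lim_1_over_n])
  obtain R where R: "\<And>x. x \<in> K \<Longrightarrow> norm x \<le> R" using compact_imp_bounded[OF K(1)] by (auto simp: bounded_iff)
  \<comment> \<open>Steps \<open>h n \<le> 1\<close> shift the support by at most
    \<open>norm a\<close>, so this ball holds the supports of all quotients.\<close>
  let ?C = "cball (0::pt) (R + norm a)"
  have [measurable]: "f \<in> borel_measurable borel" "grad f \<in> borel_measurable borel"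
    using f by (auto intro!: borel_measurable_continuous_onI test_fun_cont test_fun_cont_grad)
  have fi: "integrable lborel f" using f by (rule test_fun_integrable_self)
  define q where "q n x = (f (h n *\<^sub>R a + x) - f x) / h n" for n x
  have qz: "(\<integral>x. q n x \<partial>lborel) = 0" for n
  proof -
    have "integrable lborel (\<lambda>x. f (h n *\<^sub>R a + x))"
    proof (rule integrable_compact_support)
      show "compact ((\<lambda>x. - (h n *\<^sub>R a) + x) ` K)" by (rule compact_translation[OF K(1)])
      show "continuous_on UNIV (\<lambda>x. f (h n *\<^sub>R a + x))"
        by (rule continuous_on_compose2[OF test_fun_cont[OF f]]) (auto intro: continuous_intros)
      show "f (h n *\<^sub>R a + x) = 0" if "x \<notin> (\<lambda>x. - (h n *\<^sub>R a) + x) ` K" for x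
        by (rule K(3)) (use that in \<open>force simp: image_iff\<close>)
    qed
    then show ?thesis
      unfolding q_def using fi integral_translation[of f "h n *\<^sub>R a"] by simp
  qed
  have "(\<lambda>n. \<integral>x. q n x \<partial>lborel) \<longlonglongrightarrow> (\<integral>x. grad f x \<bullet> a \<partial>lborel)"
  proof (rule integral_dominated_convergence)
    show "(\<lambda>x. grad f x \<bullet> a) \<in> borel_measurable lborel" by measurable
    show "q n \<in> borel_measurable lborel" for n unfolding q_def by measurable
    show "integrable lborel (\<lambda>x. indicator ?C x *\<^sub>R (B * norm a))"
      by (rule borel_integrable_compact) auto
    show "AE x in lborel. norm (q n x) \<le> indicator ?C x *\<^sub>R (B * norm a)" for n
    proof (intro AE_I2)
      fix x
      show "norm (q n x) \<le> indicator ?C x *\<^sub>R (B * norm a)"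
      proof (cases "x \<in> ?C")
        case True
        have "\<bar>f (h n *\<^sub>R a + x) - f x\<bar> \<le> B * norm a * h n"
          using lip[of "h n *\<^sub>R a + x" x] h(1)[of n] by (simp add: mult_ac)
        then show ?thesis using True h(1)[of n] by (simp add: q_def pos_divide_le_eq)
      next
        case False
        then have n: "norm x > R + norm a" by auto
        have "norm (h n *\<^sub>R a) \<le> norm a" using h[of n] by (simp add: mult_left_le_one_le)
        then have "norm (h n *\<^sub>R a + x) > R"
          using n norm_triangle_ineq4[of "h n *\<^sub>R a + x" "h n *\<^sub>R a"] by (simp add: algebra_simps)
        then have "f (h n *\<^sub>R a + x) = 0" using R K(3) by (meson not_le)
        moreover have "R < norm x" using n norm_ge_zero[of a] by linarith
        then have "f x = 0" using R K(3) by (meson not_le)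
        ultimately show ?thesis using B(2) by (simp add: q_def False)
      qed
    qed
    show "AE x in lborel. (\<lambda>n. q n x) \<longlonglongrightarrow> grad f x \<bullet> a"
    proof (intro AE_I2)
      fix x
      have "((\<lambda>t. f (t *\<^sub>R a + x)) has_derivative (\<lambda>t. grad f (0 *\<^sub>R a + x) \<bullet> (t *\<^sub>R a))) (at 0)"
        by (rule has_derivative_compose[OF _ test_fun_deriv[OF f]]) (auto intro!: derivative_eq_intros)
      then have "((\<lambda>t. f (t *\<^sub>R a + x)) has_real_derivative (grad f x \<bullet> a)) (at 0)"
        by (rule has_derivative_imp_has_field_derivative) simp
      then have "((\<lambda>t. (f (t *\<^sub>R a + x) - f x) / t) \<longlongrightarrow> grad f x \<bullet> a) (at 0)"
        by (simp add: has_field_derivative_iff)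
      moreover have "filterlim h (at 0) sequentially"
        using h0 h(1) by (simp add: filterlim_at order_less_imp_not_eq2)
      ultimately show "(\<lambda>n. q n x) \<longlonglongrightarrow> grad f x \<bullet> a"
        unfolding q_def by (rule filterlim_compose)
    qed
  qed
  then show ?thesis by (simp add: qz LIMSEQ_const_iff)
qed

lemma test_fun_mult_affine:
  assumes f: "test_fun \<Omega> f"
  shows "test_fun \<Omega> (\<lambda>x. f x * (n \<bullet> x - c))"
    "grad (\<lambda>x. f x * (n \<bullet> x - c)) = (\<lambda>x. f x *\<^sub>R n + (n \<bullet> x - c) *\<^sub>R grad f x)"
proof -
  obtain K where K: "compact K" "K \<subseteq> \<Omega>" "\<And>x. x \<notin> K \<Longrightarrow> f x = 0"
    using test_fun_support[OF f] by metis
  have z: "f x * (n \<bullet> x - c) = 0" if "x \<notin> K" for x using K(3)[OF that] by simp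
  have D: "((\<lambda>x. f x * (n \<bullet> x - c)) has_derivative (\<lambda>h. (f x *\<^sub>R n + (n \<bullet> x - c) *\<^sub>R grad f x) \<bullet> h)) (at x)" for x
    by (rule has_derivative_eq_rhs)
       (auto intro!: derivative_eq_intros test_fun_deriv[OF f] simp: inner_add_left algebra_simps)
  have C: "continuous_on UNIV (\<lambda>x. f x *\<^sub>R n + (n \<bullet> x - c) *\<^sub>R grad f x)"
    by (intro continuous_intros test_fun_cont_grad[OF f] test_fun_cont[OF f])
  show "test_fun \<Omega> (\<lambda>x. f x * (n \<bullet> x - c))"
    "grad (\<lambda>x. f x * (n \<bullet> x - c)) = (\<lambda>x. f x *\<^sub>R n + (n \<bullet> x - c) *\<^sub>R grad f x)"
    using test_funI[OF D C K(1,2) z] by blast+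
qed

text \<open>The product of \<open>f\<close> and the affine factor is a test function, whose
  derivative in the unit direction \<open>n\<close> integrates to 0.\<close>

lemma integral_by_parts_affine:
  assumes f: "test_fun \<Omega> f" and n: "norm n = 1"
  shows "(\<integral>x. (n \<bullet> x - c) * (grad f x \<bullet> n) \<partial>lborel) = - (\<integral>x. f x \<partial>lborel)"
proof -
  have i: "integrable lborel (\<lambda>x. (n \<bullet> x - c) * (grad f x \<bullet> n))"
    by (rule test_fun_integrable[OF f, of "\<lambda>x a b. (n \<bullet> x - c) * (b \<bullet> n)"])
       (auto intro!: continuous_intros test_fun_cont_grad[OF f])
  have "0 = (\<integral>x. grad (\<lambda>x. f x * (n \<bullet> x - c)) x \<bullet> n \<partial>lborel)"
    by (rule integral_directional_derivative[OF test_fun_mult_affine(1)[OF f], symmetric])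
  also have "\<dots> = (\<integral>x. f x + (n \<bullet> x - c) * (grad f x \<bullet> n) \<partial>lborel)"
    using n by (simp add: test_fun_mult_affine(2)[OF f] inner_add_left dot_square_norm)
  also have "\<dots> = (\<integral>x. f x \<partial>lborel) + (\<integral>x. (n \<bullet> x - c) * (grad f x \<bullet> n) \<partial>lborel)"
    using i test_fun_integrable_self[OF f] by simp
  finally show ?thesis by simp
qed

lemma test_fun_square:
  assumes "test_fun \<Omega> f"
  shows "test_fun \<Omega> (\<lambda>x. (f x)\<^sup>2)" "grad (\<lambda>x. (f x)\<^sup>2) = (\<lambda>x. (2 * f x) *\<^sub>R grad f x)"
proof -
  have d: "((\<lambda>t::real. t\<^sup>2) has_real_derivative 2 * t) (at t)" for t
    by (auto intro!: derivative_eq_intros)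
  have c: "continuous_on UNIV (\<lambda>t::real. 2 * t)" by (intro continuous_intros)
  show "test_fun \<Omega> (\<lambda>x. (f x)\<^sup>2)" "grad (\<lambda>x. (f x)\<^sup>2) = (\<lambda>x. (2 * f x) *\<^sub>R grad f x)"
    using test_fun_compose[OF assms d c] by auto
qed

lemma L2_indicator:
  assumes "\<Omega> \<in> sets M" "emeasure M \<Omega> < \<infinity>"
  shows "L2 M (indicator \<Omega> :: 'a \<Rightarrow> real)"
proof -
  have "(\<lambda>x. (norm (indicator \<Omega> x :: real))\<^sup>2) = indicator \<Omega>"
    by (auto simp: fun_eq_iff indicator_def)
  with assms show ?thesis by (simp add: L2_def)
qed

text \<open>The case \<open>c = 0\<close> is a Poincare inequality; for \<open>c\<close> the mean of \<open>f\<close> the first factor on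
  the right is the variance, so a function of small Dirichlet energy cannot be close to a constant.\<close>

lemma strip_inequality:
  assumes f: "test_fun \<Omega> f" and \<Omega>: "\<Omega> \<in> sets lborel" "emeasure lborel \<Omega> < \<infinity>"
    and n: "norm n = 1" and B: "\<And>x. x \<in> \<Omega> \<Longrightarrow> \<bar>n \<bullet> x - b\<bar> \<le> B"
  shows "(c * (\<integral>x. f x \<partial>lborel) - (\<integral>x. (f x)\<^sup>2 \<partial>lborel) / 2)\<^sup>2
      \<le> ((\<integral>x. (f x)\<^sup>2 \<partial>lborel) - 2 * c * (\<integral>x. f x \<partial>lborel) + c\<^sup>2 * measure lborel \<Omega>) *
         (B\<^sup>2 * (\<integral>x. (norm (grad f x))\<^sup>2 \<partial>lborel))"
proof -
  let ?t = "\<integral>x. f x \<partial>lborel" and ?N = "\<integral>x. (f x)\<^sup>2 \<partial>lborel" and ?E = "\<integral>x. (norm (grad f x))\<^sup>2 \<partial>lborel"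
  obtain K where K: "compact K" "K \<subseteq> \<Omega>" "\<And>x. x \<notin> K \<Longrightarrow> f x = 0" "\<And>x. x \<notin> K \<Longrightarrow> grad f x = 0"
    using test_fun_support[OF f] by metis
  \<comment> \<open>The inequality is Cauchy-Schwarz for \<open>u\<close> and \<open>w\<close>. By
    parts, \<open>w\<close> has integral \<open>- \<integral>f\<close>, and \<open>f * w\<close> has
    integral minus half that of the square of \<open>f\<close>; the strip bounds \<open>w\<close> by
    \<open>B * norm (grad f x)\<close>.\<close>
  define w where "w x = (n \<bullet> x - b) * (grad f x \<bullet> n)" for x
  define u where "u x = c * indicator \<Omega> x - f x" for x
  have Lf: "L2 lborel f" and Lg: "L2 lborel (grad f)" using f by (auto intro: test_fun_L2 test_fun_grad_L2)
  have ci: "L2 lborel (\<lambda>x. c * indicator \<Omega> x)"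
    using L2_scaleR[OF L2_indicator[OF \<Omega>], of c] by simp
  have Lu: "L2 lborel u" unfolding u_def by (rule L2_diff[OF ci Lf])
  have cw: "continuous_on UNIV w" unfolding w_def
    by (intro continuous_intros test_fun_cont_grad[OF f])
  have wz: "w x = 0" if "x \<notin> K" for x using K(4)[OF that] by (simp add: w_def)
  have iw: "integrable lborel w" by (rule integrable_compact_support[OF K(1) cw wz])
  have Lw: "L2 lborel w"
    unfolding L2_def using cw K(1) wz
    by (auto intro!: integrable_compact_support[of K] borel_measurable_continuous_onI continuous_intros)
  have f0: "f x * indicator \<Omega> x = f x" "w x * indicator \<Omega> x = w x" for x
    using K(2-4) wz by (cases "x \<in> \<Omega>"; force)+
  have w1: "(\<integral>x. w x \<partial>lborel) = - ?t"
    unfolding w_def by (rule integral_by_parts_affine[OF f n])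
  have w2: "(\<integral>x. f x * w x \<partial>lborel) = - ?N / 2"
  proof -
    have "- ?N = (\<integral>x. (n \<bullet> x - b) * (grad (\<lambda>x. (f x)\<^sup>2) x \<bullet> n) \<partial>lborel)"
      by (rule integral_by_parts_affine[OF test_fun_square(1)[OF f] n, symmetric])
    also have "\<dots> = (\<integral>x. 2 * (f x * w x) \<partial>lborel)"
      by (simp add: test_fun_square(2)[OF f] w_def mult_ac)
    finally show ?thesis by simp
  qed
  have "(\<integral>x. u x \<bullet> w x \<partial>lborel) = (\<integral>x. c * w x - f x * w x \<partial>lborel)"
    by (intro Bochner_Integration.integral_cong refl) (simp add: u_def left_diff_distrib mult.assoc mult.commute[of "indicator \<Omega> _"] f0)
  also have "\<dots> = - (c * ?t - ?N / 2)"
    using iw L2_inner_integrable[OF Lf Lw] w1 w2 by simp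
  finally have uw: "(\<integral>x. u x \<bullet> w x \<partial>lborel) = - (c * ?t - ?N / 2)" .
  have "(\<integral>x. (norm (u x))\<^sup>2 \<partial>lborel) = (\<integral>x. c\<^sup>2 * indicator \<Omega> x - (2 * c) * f x + (f x)\<^sup>2 \<partial>lborel)"
  proof (intro Bochner_Integration.integral_cong refl)
    fix x
    show "(norm (u x))\<^sup>2 = c\<^sup>2 * indicator \<Omega> x - (2 * c) * f x + (f x)\<^sup>2"
      using f0(1)[of x] by (cases "x \<in> \<Omega>") (auto simp: u_def power2_diff)
  qed
  also have "\<dots> = c\<^sup>2 * measure lborel \<Omega> - 2 * c * ?t + ?N"
    using \<Omega> test_fun_integrable_self[OF f] L2_integrable_norm[OF Lf] by simp
  finally have uu: "(\<integral>x. (norm (u x))\<^sup>2 \<partial>lborel) = c\<^sup>2 * measure lborel \<Omega> - 2 * c * ?t + ?N" .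
  have ww: "(\<integral>x. (norm (w x))\<^sup>2 \<partial>lborel) \<le> B\<^sup>2 * ?E"
  proof -
    have "(\<integral>x. (norm (w x))\<^sup>2 \<partial>lborel) \<le> (\<integral>x. B\<^sup>2 * (norm (grad f x))\<^sup>2 \<partial>lborel)"
    proof (rule integral_mono)
      show "(norm (w x))\<^sup>2 \<le> B\<^sup>2 * (norm (grad f x))\<^sup>2" for x
      proof (cases "x \<in> \<Omega>")
        case True
        have "\<bar>w x\<bar> \<le> B * norm (grad f x)"
          unfolding w_def abs_mult using Cauchy_Schwarz_ineq2[of "grad f x" n] n B[OF True]
          by (intro mult_mono) auto
        then have "\<bar>w x\<bar>\<^sup>2 \<le> (B * norm (grad f x))\<^sup>2" by (rule power_mono) simp
        then show ?thesis by (simp add: power_mult_distrib)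
      next
        case False
        then have "x \<notin> K" using K(2) by blast
        then show ?thesis using wz by simp
      qed
    qed (use Lw Lg in \<open>auto simp: L2_def\<close>)
    then show ?thesis by simp
  qed
  have "(c * ?t - ?N / 2)\<^sup>2 = (\<integral>x. u x \<bullet> w x \<partial>lborel)\<^sup>2" unfolding uw by (simp only: power2_minus)
  also have "\<dots> \<le> (\<integral>x. (norm (u x))\<^sup>2 \<partial>lborel) * (\<integral>x. (norm (w x))\<^sup>2 \<partial>lborel)"
    by (rule L2_Cauchy_Schwarz[OF Lu Lw])
  also have "\<dots> \<le> (\<integral>x. (norm (u x))\<^sup>2 \<partial>lborel) * (B\<^sup>2 * ?E)"
    by (intro mult_left_mono ww) simp
  finally show ?thesis unfolding uu by (simp add: algebra_simps)
qed

text \<open>At \<open>c = 0\<close> the strip inequality has a factor \<open>\<integral>f^2\<close>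
  on both sides, which cancels unless it is 0.\<close>

lemma poincare_inequality:
  assumes f: "test_fun \<Omega> f" and \<Omega>: "\<Omega> \<in> sets lborel" "emeasure lborel \<Omega> < \<infinity>"
    and n: "norm n = 1" and B: "\<And>x. x \<in> \<Omega> \<Longrightarrow> \<bar>n \<bullet> x - b\<bar> \<le> B"
  shows "(\<integral>x. (f x)\<^sup>2 \<partial>lborel) \<le> 4 * B\<^sup>2 * (\<integral>x. (norm (grad f x))\<^sup>2 \<partial>lborel)"
proof (cases "(\<integral>x. (f x)\<^sup>2 \<partial>lborel) = 0")
  case False
  then have "(\<integral>x. (f x)\<^sup>2 \<partial>lborel) > 0" by (simp add: less_le)
  with strip_inequality[OF assms, of 0] show ?thesis by (simp add: power2_eq_square)
qed simp

text \<open>Cauchy-Schwarz against the indicator of \<open>\<Omega>\<close>, off which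
  \<open>f\<close> vanishes.\<close>

lemma integral_test_fun_square_le:
  assumes f: "test_fun \<Omega> f" and \<Omega>: "\<Omega> \<in> sets lborel" "emeasure lborel \<Omega> < \<infinity>"
  shows "(\<integral>x. f x \<partial>lborel)\<^sup>2 \<le> measure lborel \<Omega> * (\<integral>x. (f x)\<^sup>2 \<partial>lborel)"
proof -
  obtain K where K: "K \<subseteq> \<Omega>" "\<And>x. x \<notin> K \<Longrightarrow> f x = 0"
    using test_fun_support[OF f] by metis
  have "indicator \<Omega> x * f x = f x" for x using K by (cases "x \<in> \<Omega>") auto
  moreover have "(norm (indicator \<Omega> x :: real))\<^sup>2 = indicator \<Omega> x" for x :: pt
    by (simp add: indicator_def)
  ultimately show ?thesis
    using L2_Cauchy_Schwarz[OF L2_indicator[OF \<Omega>] test_fun_L2[OF f]] \<Omega> by (simp only: inner_real_def) simp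
qed

section \<open>Approximating sequences and the Rayleigh quotient\<close>

lemma in_H01_E:
  assumes "in_H01 \<Omega> v g"
  obtains \<phi> where "\<And>n. test_fun \<Omega> (\<phi> n)" "L2 lborel v" "L2 lborel g"
    "(\<lambda>n. \<integral>x. (norm (\<phi> n x - v x))\<^sup>2 \<partial>lborel) \<longlonglongrightarrow> 0"
    "(\<lambda>n. \<integral>x. (norm (grad (\<phi> n) x - g x))\<^sup>2 \<partial>lborel) \<longlonglongrightarrow> 0"
proof -
  obtain \<phi> where \<phi>: "\<And>n. test_fun \<Omega> (\<phi> n)"
    "(\<lambda>n. \<integral>\<^sup>+ x. ennreal ((norm (\<phi> n x - v x))\<^sup>2) \<partial>lborel) \<longlonglongrightarrow> 0"
    "(\<lambda>n. \<integral>\<^sup>+ x. ennreal ((norm (grad (\<phi> n) x - g x))\<^sup>2) \<partial>lborel) \<longlonglongrightarrow> 0"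
    using assms by (auto simp: in_H01_def)
  have m: "v \<in> borel_measurable lborel" "g \<in> borel_measurable lborel"
    using assms by (auto simp: in_H01_def)
  note v = L2_limit[OF m(1) test_fun_L2[OF \<phi>(1)] \<phi>(2)]
  note g = L2_limit[OF m(2) test_fun_grad_L2[OF \<phi>(1)] \<phi>(3)]
  show ?thesis by (rule that[OF \<phi>(1) v(1) g(1) v(2) g(2)])
qed

lemma test_fun_in_H01: "test_fun \<Omega> f \<Longrightarrow> in_H01 \<Omega> f (grad f)"
  unfolding in_H01_def using test_fun_L2[of \<Omega> f] test_fun_grad_L2[of \<Omega> f]
  by (auto simp: L2_def intro!: exI[of _ "\<lambda>_. f"])

text \<open>The quotient is multiplied out so that functions of norm 0 are covered and both sides
  pass to limits.\<close>

lemma lambda1_le: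
  assumes "test_fun \<Omega> f"
  shows "lambda1 \<Omega> * (\<integral>x. (f x)\<^sup>2 \<partial>lborel) \<le> (\<integral>x. (norm (grad f x))\<^sup>2 \<partial>lborel)"
proof (cases "(\<integral>x. (f x)\<^sup>2 \<partial>lborel) = 0")
  case False
  then have pos: "(\<integral>x. (f x)\<^sup>2 \<partial>lborel) > 0" by (simp add: less_le)
  have "(\<integral>\<^sup>+ x. ennreal ((f x)\<^sup>2) \<partial>lborel) = ennreal (\<integral>x. (f x)\<^sup>2 \<partial>lborel)"
    using L2_integrable_norm[OF test_fun_L2[OF assms]] by (intro nn_integral_eq_integral) auto
  then have "(\<integral>\<^sup>+ x. ennreal ((f x)\<^sup>2) \<partial>lborel) \<noteq> 0" using pos by simp
  then have "lambda1 \<Omega> \<le> (\<integral>x. (norm (grad f x))\<^sup>2 \<partial>lborel) / (\<integral>x. (f x)\<^sup>2 \<partial>lborel)"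
    unfolding lambda1_def using test_fun_in_H01[OF assms]
    by (intro cInf_lower bdd_belowI[of _ 0]) auto
  then show ?thesis using pos by (simp add: field_simps)
qed simp

section \<open>The torsion function\<close>

lemma test_fun_zero: "test_fun \<Omega> (\<lambda>_. 0)"
  by (rule test_funI[of _ "\<lambda>_. 0" "{}"]) auto

lemma torsion_sol_in_H01: "torsion_sol \<Omega> v g \<Longrightarrow> in_H01 \<Omega> v g"
  by (simp add: torsion_sol_def)

text \<open>Direct method for the functional \<open>J\<close>. Near-minimisers are Cauchy in energy
  by the parallelogram identity, hence in \<open>L2\<close> by the Poincare inequality
  \<open>C\<close>; the first variation at the limit is the torsion equation.\<close>

lemma torsion_exists:
  assumes \<Omega>: "\<Omega> \<in> sets lborel" "emeasure lborel \<Omega> < \<infinity>"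
    and C: "C \<ge> 0" "\<And>f. test_fun \<Omega> f \<Longrightarrow> (\<integral>x. (f x)\<^sup>2 \<partial>lborel) \<le> C * (\<integral>x. (norm (grad f x))\<^sup>2 \<partial>lborel)"
  shows "\<exists>v g. torsion_sol \<Omega> v g"
proof -
  define E where "E f = (\<integral>x. (norm (grad f x))\<^sup>2 \<partial>lborel)" for f :: "pt \<Rightarrow> real"
  define t where "t f = (\<integral>x. f x \<partial>lborel)" for f :: "pt \<Rightarrow> real"
  define J where "J f = E f / 2 - t f" for f
  define A where "A = measure lborel \<Omega>"
  have A: "A \<ge> 0" by (simp add: A_def)
  have E0: "E f \<ge> 0" for f by (simp add: E_def)
  \<comment> \<open>The linear term is controlled by Cauchy-Schwarz, the Poincare inequality and
    \<open>4 * x * y \<le> (x + y)^2\<close>.\<close>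
  have low: "J f \<ge> - (A * C) / 2" if f: "test_fun \<Omega> f" for f
  proof -
    have "(t f)\<^sup>2 \<le> A * (\<integral>x. (f x)\<^sup>2 \<partial>lborel)"
      unfolding t_def A_def by (rule integral_test_fun_square_le[OF f \<Omega>])
    also have "\<dots> \<le> A * (C * E f)"
      using C(2)[OF f] A by (intro mult_left_mono) (auto simp: E_def)
    finally have "(2 * t f)\<^sup>2 \<le> 4 * ((A * C) * E f)" by (simp add: power_mult_distrib mult.assoc)
    also have "\<dots> \<le> (A * C + E f)\<^sup>2"
      using sum_squares_bound[of "A * C" "E f"] by (simp add: power2_sum)
    finally have "2 * t f \<le> A * C + E f"
      by (rule power2_le_imp_le) (use A C(1) E0[of f] in simp)
    then show ?thesis by (simp add: J_def)
  qed
  define S where "S = J ` {f. test_fun \<Omega> f}"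
  define m where "m = Inf S"
  have bdd: "bdd_below S" unfolding S_def using low by (auto intro: bdd_belowI[of _ "- (A * C) / 2"])
  have ne: "S \<noteq> {}" unfolding S_def using test_fun_zero[of \<Omega>] by blast
  have m: "m \<le> J f" if "test_fun \<Omega> f" for f
    unfolding m_def using that by (intro cInf_lower bdd) (auto simp: S_def)
  \<comment> \<open>The rate \<open>(1/4) ^ k\<close> is the one that \<open>L2_complete\<close>
    expects.\<close>
  have "\<exists>f. test_fun \<Omega> f \<and> J f < m + (1/4) ^ k" for k :: nat
  proof -
    have "Inf S < m + (1/4) ^ k" by (simp add: m_def)
    from cInf_lessD[OF ne this] show ?thesis by (auto simp: S_def)
  qed
  then obtain \<phi> where \<phi>: "\<And>k. test_fun \<Omega> (\<phi> k)" "\<And>k. J (\<phi> k) < m + (1/4) ^ k" by metis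
  note Lg = test_fun_grad_L2[OF \<phi>(1)] and Lf = test_fun_L2[OF \<phi>(1)]
  have expand: "E (\<lambda>x. f x + s * g x) = E f + 2 * s * (\<integral>x. grad f x \<bullet> grad g x \<partial>lborel) + s\<^sup>2 * E g"
    "t (\<lambda>x. f x + s * g x) = t f + s * t g" "test_fun \<Omega> (\<lambda>x. f x + s * g x)"
    if f: "test_fun \<Omega> f" and g: "test_fun \<Omega> g" for f g s
  proof -
    note sg = test_fun_scale[OF g, of s]
    show "test_fun \<Omega> (\<lambda>x. f x + s * g x)" by (rule test_fun_add[OF f sg(1)])
    show "t (\<lambda>x. f x + s * g x) = t f + s * t g"
      unfolding t_def using test_fun_integrable_self[OF f] test_fun_integrable_self[OF g] by simp
    show "E (\<lambda>x. f x + s * g x) = E f + 2 * s * (\<integral>x. grad f x \<bullet> grad g x \<partial>lborel) + s\<^sup>2 * E g"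
      unfolding E_def test_fun_add(2)[OF f sg(1)] sg(2)
      using L2_norm_diff_expand[OF test_fun_grad_L2[OF f] test_fun_grad_L2[OF g], of "-s"] by simp
  qed
  \<comment> \<open>The left side is 4 times \<open>J\<close> at both ends minus twice
    \<open>J\<close> at the midpoint, where \<open>J\<close> is at least \<open>m\<close>. This
    gives less than \<open>5 * (1/4) ^ k\<close>; the 8 leaves room.\<close>
  have dE: "E (\<lambda>x. \<phi> (Suc k) x - \<phi> k x) \<le> 8 * (1/4) ^ k" for k
  proof -
    let ?b = "\<integral>x. grad (\<phi> (Suc k)) x \<bullet> grad (\<phi> k) x \<partial>lborel"
    have "E (\<lambda>x. \<phi> (Suc k) x - \<phi> k x) = E (\<phi> (Suc k)) - 2 * ?b + E (\<phi> k)"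
      using expand(1)[OF \<phi>(1) \<phi>(1), of "Suc k" "-1" k] by simp
    moreover have "m \<le> J (\<lambda>x. (1/2) * (\<phi> (Suc k) x + 1 * \<phi> k x))"
      by (rule m[OF test_fun_scale(1)[OF expand(3)[OF \<phi>(1) \<phi>(1)]]])
    moreover have "J (\<lambda>x. (1/2) * (\<phi> (Suc k) x + 1 * \<phi> k x)) =
        (E (\<phi> (Suc k)) + 2 * ?b + E (\<phi> k)) / 8 - (t (\<phi> (Suc k)) + t (\<phi> k)) / 2"
    proof -
      let ?h = "\<lambda>x. \<phi> (Suc k) x + 1 * \<phi> k x"
      have X: "E (\<lambda>x. (1/2) * ?h x) = E ?h / 4"
        unfolding E_def test_fun_scale(2)[OF expand(3)[OF \<phi>(1) \<phi>(1)]] norm_scaleR power_mult_distrib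
        by (simp add: power2_eq_square)
      have Y: "t (\<lambda>x. (1/2) * ?h x) = t ?h / 2"
        unfolding t_def by simp
      show ?thesis
        unfolding J_def X Y expand(1,2)[OF \<phi>(1) \<phi>(1), of "Suc k" 1 k] by simp
    qed
    moreover have "J (\<phi> (Suc k)) < m + (1/4) * (1/4) ^ k" using \<phi>(2)[of "Suc k"] by simp
    moreover have "(0::real) \<le> (1/4) ^ k" by simp
    ultimately show ?thesis using \<phi>(2)[of k] unfolding J_def by argo
  qed
  have "\<exists>g. L2 lborel g \<and> (\<lambda>n. \<integral>\<^sup>+ x. ennreal ((norm (grad (\<phi> n) x - g x))\<^sup>2) \<partial>lborel) \<longlonglongrightarrow> 0"
  proof (rule L2_complete[OF Lg])
    show "(\<integral>x. (norm (grad (\<phi> (Suc n)) x - grad (\<phi> n) x))\<^sup>2 \<partial>lborel) \<le> 8 * (1/4) ^ n" for n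
      using dE[of n] unfolding E_def test_fun_diff(2)[OF \<phi>(1) \<phi>(1)] .
  qed
  then obtain g where g: "L2 lborel g"
    "(\<lambda>n. \<integral>\<^sup>+ x. ennreal ((norm (grad (\<phi> n) x - g x))\<^sup>2) \<partial>lborel) \<longlonglongrightarrow> 0" by blast
  have "\<exists>v. L2 lborel v \<and> (\<lambda>n. \<integral>\<^sup>+ x. ennreal ((norm (\<phi> n x - v x))\<^sup>2) \<partial>lborel) \<longlonglongrightarrow> 0"
  proof (rule L2_complete[OF Lf])
    show "(\<integral>x. (norm (\<phi> (Suc n) x - \<phi> n x))\<^sup>2 \<partial>lborel) \<le> (C * 8) * (1/4) ^ n" for n
      using C(2)[OF test_fun_diff(1)[OF \<phi>(1) \<phi>(1)], of "Suc n" n] mult_left_mono[OF dE[of n] C(1)]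
      by (simp add: E_def mult.assoc)
  qed
  then obtain v where v: "L2 lborel v"
    "(\<lambda>n. \<integral>\<^sup>+ x. ennreal ((norm (\<phi> n x - v x))\<^sup>2) \<partial>lborel) \<longlonglongrightarrow> 0" by blast
  have H: "in_H01 \<Omega> v g"
    unfolding in_H01_def using \<phi>(1) v g by (auto simp: L2_def intro!: exI[of _ \<phi>])
  have "(\<integral>x. g x \<bullet> grad \<psi> x \<partial>lborel) = (\<integral>x. \<psi> x \<partial>lborel)" if \<psi>: "test_fun \<Omega> \<psi>" for \<psi>
  proof -
    define b where "b k = (\<integral>x. grad (\<phi> k) x \<bullet> grad \<psi> x \<partial>lborel)" for k
    define d where "d = (\<integral>x. g x \<bullet> grad \<psi> x \<partial>lborel) - t \<psi>"
    have b: "b \<longlonglongrightarrow> (\<integral>x. g x \<bullet> grad \<psi> x \<partial>lborel)"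
      unfolding b_def using test_fun_grad_L2[OF \<psi>]
      by (intro L2_tendsto_inner L2_limit(2)[OF L2_measurable[OF g(1)] Lg g(2)] Lg g(1)) auto
    \<comment> \<open>Comparing \<open>J (\<phi> k + s * \<psi>)\<close> with \<open>m\<close> costs
      the gap \<open>(1/4) ^ k\<close>, which disappears in the limit.\<close>
    have var: "0 \<le> s * d + s\<^sup>2 / 2 * E \<psi>" for s
    proof (rule LIMSEQ_le_const)
      have "(\<lambda>k. (1/4) ^ k + (s * (b k - t \<psi>) + s\<^sup>2 / 2 * E \<psi>)) \<longlonglongrightarrow> 0 + (s * d + s\<^sup>2 / 2 * E \<psi>)"
        unfolding d_def by (intro tendsto_intros b LIMSEQ_power_zero) auto
      then show "(\<lambda>k. (1/4) ^ k + (s * (b k - t \<psi>) + s\<^sup>2 / 2 * E \<psi>)) \<longlonglongrightarrow> s * d + s\<^sup>2 / 2 * E \<psi>" by simp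
      have "0 \<le> (1/4) ^ k + (s * (b k - t \<psi>) + s\<^sup>2 / 2 * E \<psi>)" for k
      proof -
        have "m \<le> E (\<phi> k) / 2 + s * b k + s\<^sup>2 / 2 * E \<psi> - t (\<phi> k) - s * t \<psi>"
          using m[OF expand(3)[OF \<phi>(1) \<psi>, of k s]] unfolding J_def expand[OF \<phi>(1) \<psi>] b_def by (simp add: field_simps)
        with \<phi>(2)[of k] show ?thesis unfolding J_def right_diff_distrib by argo
      qed
      then show "\<exists>N. \<forall>n\<ge>N. 0 \<le> (1/4) ^ n + (s * (b n - t \<psi>) + s\<^sup>2 / 2 * E \<psi>)" by blast
    qed
    have "d = 0"
    proof (rule ccontr)
      assume "d \<noteq> 0"
      let ?e = "E \<psi>"
      have e: "?e + 1 > 0" using E0[of \<psi>] by simp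
      \<comment> \<open>The choice of \<open>s\<close> opposes the sign of \<open>d\<close> and
        makes the linear term win; adding 1 keeps the denominator positive even when the energy of
        \<open>\<psi>\<close> is 0.\<close>
      have "(-d / (?e + 1)) * d + (-d / (?e + 1))\<^sup>2 / 2 * ?e = - (d\<^sup>2 * (?e + 2)) / (2 * (?e + 1)\<^sup>2)"
        using e by (simp add: divide_simps power2_eq_square) (simp add: algebra_simps)
      moreover have "d\<^sup>2 * (?e + 2) / (2 * (?e + 1)\<^sup>2) > 0"
        using e E0[of \<psi>] \<open>d \<noteq> 0\<close> by (intro divide_pos_pos mult_pos_pos) auto
      ultimately show False using var[of "-d / (?e + 1)"] by simp
    qed
    then show ?thesis by (simp add: d_def t_def)
  qed
  with H show ?thesis unfolding torsion_sol_def by blast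
qed

text \<open>The difference of the gradients is orthogonal to all test gradients. Both gradients are
  limits of such, so it is orthogonal to itself; the Poincare inequality in the limit then
  identifies the functions.\<close>

lemma torsion_unique:
  assumes C: "\<And>f. test_fun \<Omega> f \<Longrightarrow> (\<integral>x. (f x)\<^sup>2 \<partial>lborel) \<le> C * (\<integral>x. (norm (grad f x))\<^sup>2 \<partial>lborel)"
    and 1: "torsion_sol \<Omega> v g" and 2: "torsion_sol \<Omega> v' g'"
  shows "AE x in lborel. v x = v' x"
proof -
  obtain \<phi> where \<phi>: "\<And>n. test_fun \<Omega> (\<phi> n)" "L2 lborel v" "L2 lborel g"
    "(\<lambda>n. \<integral>x. (norm (\<phi> n x - v x))\<^sup>2 \<partial>lborel) \<longlonglongrightarrow> 0"
    "(\<lambda>n. \<integral>x. (norm (grad (\<phi> n) x - g x))\<^sup>2 \<partial>lborel) \<longlonglongrightarrow> 0"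
    by (rule in_H01_E[OF torsion_sol_in_H01[OF 1]]) (rule that)
  obtain \<psi> where \<psi>: "\<And>n. test_fun \<Omega> (\<psi> n)" "L2 lborel v'" "L2 lborel g'"
    "(\<lambda>n. \<integral>x. (norm (\<psi> n x - v' x))\<^sup>2 \<partial>lborel) \<longlonglongrightarrow> 0"
    "(\<lambda>n. \<integral>x. (norm (grad (\<psi> n) x - g' x))\<^sup>2 \<partial>lborel) \<longlonglongrightarrow> 0"
    by (rule in_H01_E[OF torsion_sol_in_H01[OF 2]]) (rule that)
  let ?h = "\<lambda>x. g x - g' x"
  have Lh: "L2 lborel ?h" by (rule L2_diff[OF \<phi>(3) \<psi>(3)])
  have orth: "(\<integral>x. grad f x \<bullet> ?h x \<partial>lborel) = 0" if f: "test_fun \<Omega> f" for f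
  proof -
    have "(\<integral>x. grad f x \<bullet> ?h x \<partial>lborel) = (\<integral>x. g x \<bullet> grad f x - g' x \<bullet> grad f x \<partial>lborel)"
      by (simp add: inner_diff inner_commute)
    also have "\<dots> = (\<integral>x. g x \<bullet> grad f x \<partial>lborel) - (\<integral>x. g' x \<bullet> grad f x \<partial>lborel)"
      using L2_inner_integrable[OF \<phi>(3) test_fun_grad_L2[OF f]] L2_inner_integrable[OF \<psi>(3) test_fun_grad_L2[OF f]] by simp
    also have "\<dots> = 0" using 1 2 f by (simp add: torsion_sol_def)
    finally show ?thesis .
  qed
  have h0: "(\<lambda>n. \<integral>x. (norm (?h x - ?h x))\<^sup>2 \<partial>lborel) \<longlonglongrightarrow> 0" by simp
  have g1: "(\<integral>x. g x \<bullet> ?h x \<partial>lborel) = 0"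
    using L2_tendsto_inner[OF test_fun_grad_L2[OF \<phi>(1)] \<phi>(3,5) Lh Lh h0] by (simp add: orth[OF \<phi>(1)] LIMSEQ_const_iff)
  have g2: "(\<integral>x. g' x \<bullet> ?h x \<partial>lborel) = 0"
    using L2_tendsto_inner[OF test_fun_grad_L2[OF \<psi>(1)] \<psi>(3,5) Lh Lh h0] by (simp add: orth[OF \<psi>(1)] LIMSEQ_const_iff)
  have "(\<integral>x. (norm (?h x))\<^sup>2 \<partial>lborel) = (\<integral>x. g x \<bullet> ?h x - g' x \<bullet> ?h x \<partial>lborel)"
    by (simp add: power2_norm_eq_inner inner_diff_left)
  also have "\<dots> = 0"
    using L2_inner_integrable[OF \<phi>(3) Lh] L2_inner_integrable[OF \<psi>(3) Lh] g1 g2 by simp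
  finally have hz: "(\<integral>x. (norm (?h x))\<^sup>2 \<partial>lborel) = 0" .
  have "(\<integral>x. (norm (v x - v' x))\<^sup>2 \<partial>lborel) \<le> C * (\<integral>x. (norm (?h x))\<^sup>2 \<partial>lborel)"
  proof (rule LIMSEQ_le)
    show "(\<lambda>n. \<integral>x. (norm (\<phi> n x - \<psi> n x))\<^sup>2 \<partial>lborel) \<longlonglongrightarrow> (\<integral>x. (norm (v x - v' x))\<^sup>2 \<partial>lborel)"
      by (rule L2_tendsto_norm_diff[OF test_fun_L2[OF \<phi>(1)] \<phi>(2,4) test_fun_L2[OF \<psi>(1)] \<psi>(2,4)])
    show "(\<lambda>n. C * (\<integral>x. (norm (grad (\<phi> n) x - grad (\<psi> n) x))\<^sup>2 \<partial>lborel)) \<longlonglongrightarrow> C * (\<integral>x. (norm (?h x))\<^sup>2 \<partial>lborel)"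
      by (intro tendsto_mult tendsto_const
          L2_tendsto_norm_diff[OF test_fun_grad_L2[OF \<phi>(1)] \<phi>(3,5) test_fun_grad_L2[OF \<psi>(1)] \<psi>(3,5)])
    show "\<exists>N. \<forall>n\<ge>N. (\<integral>x. (norm (\<phi> n x - \<psi> n x))\<^sup>2 \<partial>lborel) \<le> C * (\<integral>x. (norm (grad (\<phi> n) x - grad (\<psi> n) x))\<^sup>2 \<partial>lborel)"
      using C[OF test_fun_diff(1)[OF \<phi>(1) \<psi>(1)]] unfolding test_fun_diff(2)[OF \<phi>(1) \<psi>(1)] by auto
  qed
  then have "(\<integral>x. (norm (v x - v' x))\<^sup>2 \<partial>lborel) \<le> 0" unfolding hz by simp
  then have "(\<integral>x. (norm (v x - v' x))\<^sup>2 \<partial>lborel) = 0" by (intro antisym) auto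
  then have "AE x in lborel. (norm (v x - v' x))\<^sup>2 = 0"
    using L2_diff[OF \<phi>(2) \<psi>(2)] by (subst (asm) integral_nonneg_eq_0_iff_AE) (auto simp: L2_def)
  then show ?thesis by simp
qed

text \<open>Uniqueness almost everywhere makes the definite description determinate, so any torsion
  solution computes it.\<close>

lemma torsion_Lp_eq:
  assumes C: "\<And>f. test_fun \<Omega> f \<Longrightarrow> (\<integral>x. (f x)\<^sup>2 \<partial>lborel) \<le> C * (\<integral>x. (norm (grad f x))\<^sup>2 \<partial>lborel)"
    and v: "torsion_sol \<Omega> v g"
  shows "torsion_Lp p \<Omega> = (\<integral>x. \<bar>v x\<bar> powr p \<partial>lborel) powr (1 / p)"
  unfolding torsion_Lp_def
proof (rule the_equality)
  show "\<exists>v' g. torsion_sol \<Omega> v' g \<and>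
      (\<integral>x. \<bar>v x\<bar> powr p \<partial>lborel) powr (1 / p) = (\<integral>x. \<bar>v' x\<bar> powr p \<partial>lborel) powr (1 / p)"
    using v by blast
  fix s assume "\<exists>v g. torsion_sol \<Omega> v g \<and> s = (\<integral>x. \<bar>v x\<bar> powr p \<partial>lborel) powr (1 / p)"
  then obtain v' g' where v': "torsion_sol \<Omega> v' g'" and s: "s = (\<integral>x. \<bar>v' x\<bar> powr p \<partial>lborel) powr (1 / p)"
    by blast
  have [measurable]: "v \<in> borel_measurable lborel" "v' \<in> borel_measurable lborel"
    using v v' by (auto simp: torsion_sol_def in_H01_def)
  have "(\<integral>x. \<bar>v' x\<bar> powr p \<partial>lborel) = (\<integral>x. \<bar>v x\<bar> powr p \<partial>lborel)"
    by (intro integral_cong_AE) (use torsion_unique[OF C v' v] in auto)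
  then show "s = (\<integral>x. \<bar>v x\<bar> powr p \<partial>lborel) powr (1 / p)" by (simp add: s)
qed

section \<open>Convex planar sets\<close>

text \<open>A point far from a ball in \<open>S\<close> spans with it a long cone inside
  \<open>S\<close>, which contains too many disjoint balls of half the radius.\<close>

lemma convex_finite_measure_imp_bounded:
  fixes S :: "'a::euclidean_space set"
  assumes "open S" "convex S" "emeasure lborel S < \<infinity>"
  shows "bounded S"
proof (cases "S = {}")
  case False
  then obtain a r where r: "r > 0" and ball: "ball a r \<subseteq> S"
    using \<open>open S\<close> by (meson all_not_in_conv openE)
  define V where "V = measure lborel (ball (0::'a) (r/2))"
  have V: "V > 0" unfolding V_def using r by (intro content_ball_pos) simp
  have Vt: "measure lborel (ball c (r/2)) = V" for c :: 'a
    unfolding V_def using r content_ball_conv_unit_ball[of "r/2" c] content_ball_conv_unit_ball[of "r/2" "0::'a"] by simp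
  obtain N :: nat where N: "measure lborel S < real N * V"
    using reals_Archimedean3[OF V] by blast
  have "norm (x - a) \<le> 2 * real N * r" if x: "x \<in> S" for x
  proof (rule ccontr)
    assume "\<not> norm (x - a) \<le> 2 * real N * r"
    then have L: "norm (x - a) > 2 * real N * r" by simp
    then have L0: "norm (x - a) > 0" using r by (smt (verit) mult_nonneg_nonneg of_nat_0_le_iff)
    \<comment> \<open>The centres lie at distance \<open>j * r\<close> from \<open>a\<close>, so
      balls of radius \<open>r/2\<close> are disjoint. The length \<open>2 * N * r\<close> keeps
      them in the first half of the segment, where the cone is still that thick.\<close>
    define t where "t j = real j * r / norm (x - a)" for j :: nat
    define c where "c j = a + t j *\<^sub>R (x - a)" for j
    have t: "0 \<le> t j" "t j \<le> 1/2" if "j < N" for j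
    proof -
      show "0 \<le> t j" using r by (simp add: t_def)
      have "real j * r \<le> real N * r" using that r by (intro mult_right_mono) auto
      then show "t j \<le> 1/2" using L L0 by (simp add: t_def field_simps)
    qed
    have sub: "ball (c j) (r/2) \<subseteq> S" if j: "j < N" for j
    proof
      fix y assume y: "y \<in> ball (c j) (r/2)"
      \<comment> \<open>The homothety centred at \<open>x\<close> with ratio \<open>1 - t j\<close>
        maps \<open>a\<close> to \<open>c j\<close>; \<open>z\<close> is the preimage of
        \<open>y\<close>.\<close>
      define z where "z = a + (1 / (1 - t j)) *\<^sub>R (y - c j)"
      have p: "1 - t j > 0" using t[OF j] by simp
      have "norm (y - c j) < r / 2" using y by (simp add: dist_norm norm_minus_commute)
      also have "r / 2 \<le> r * (1 - t j)" using t[OF j] r by (simp add: field_simps)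
      finally have "norm (z - a) < r" using p by (simp add: z_def pos_divide_less_eq)
      then have "z \<in> S" using ball by (auto simp: dist_norm norm_minus_commute)
      moreover have "(1 - t j) *\<^sub>R z = (1 - t j) *\<^sub>R a + (y - c j)"
        using p by (simp add: z_def scaleR_add_right)
      then have "y = (1 - t j) *\<^sub>R z + t j *\<^sub>R x"
        by (simp add: c_def algebra_simps)
      ultimately show "y \<in> S"
        using \<open>convex S\<close> x t[OF j] by (simp add: convex_def)
    qed
    have disj: "disjoint_family_on (\<lambda>j. ball (c j) (r/2)) {..<N}"
    proof (unfold disjoint_family_on_def, intro ballI impI)
      fix i j assume ij: "i \<noteq> (j::nat)"
      have "c i - c j = (t i - t j) *\<^sub>R (x - a)" by (simp add: c_def algebra_simps)
      then have "dist (c i) (c j) = \<bar>(real i - real j) * r / norm (x - a)\<bar> * norm (x - a)"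
        by (simp add: dist_norm t_def left_diff_distrib diff_divide_distrib)
      also have "\<dots> = \<bar>real i - real j\<bar> * r" using L0 r by (simp add: abs_mult)
      also have "\<dots> \<ge> 1 * r" using ij r by (intro mult_right_mono) auto
      finally have d: "dist (c i) (c j) \<ge> r" by simp
      show "ball (c i) (r/2) \<inter> ball (c j) (r/2) = {}"
      proof (rule ccontr)
        assume "ball (c i) (r/2) \<inter> ball (c j) (r/2) \<noteq> {}"
        then obtain y where "dist (c i) y < r/2" "dist (c j) y < r/2" by auto
        then show False using d dist_triangle2[of "c i" "c j" y] by linarith
      qed
    qed
    have "real N * V = (\<Sum>j<N. measure lborel (ball (c j) (r/2)))" by (simp add: Vt)
    also have "\<dots> = measure lborel (\<Union>j<N. ball (c j) (r/2))"
      by (rule measure_finite_Union[symmetric]) (use disj emeasure_lborel_ball_finite in \<open>auto simp: less_top[symmetric]\<close>)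
    also have "\<dots> \<le> measure lborel S"
      using sub assms by (intro measure_mono_fmeasurable) (auto intro!: fmeasurableI)
    finally show False using N by simp
  qed
  then have "\<forall>x\<in>S. norm x \<le> norm a + 2 * real N * r"
    by (metis add.commute norm_triangle_sub order_trans add_left_mono)
  then show ?thesis by (auto simp: bounded_iff)
qed simp

text \<open>\<open>n\<close> is \<open>e\<close> turned by a right angle, so the two form an
  orthonormal basis of the plane.\<close>

lemma vec2_decomp:
  fixes e u :: pt
  assumes e: "norm e = 1" and n: "n = vector [- e $ 2, e $ 1]"
  shows "u = (e \<bullet> u) *\<^sub>R e + (n \<bullet> u) *\<^sub>R n" "norm n = 1" "e \<bullet> n = 0"
    "(norm u)\<^sup>2 = (e \<bullet> u)\<^sup>2 + (n \<bullet> u)\<^sup>2"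
proof -
  have 1: "(e $ 1)\<^sup>2 + (e $ 2)\<^sup>2 = 1"
    using e by (simp add: norm_eq_1 inner_vec_def sum_2 power2_eq_square)
  have i: "e \<bullet> u = e $ 1 * u $ 1 + e $ 2 * u $ 2" "n \<bullet> u = - e $ 2 * u $ 1 + e $ 1 * u $ 2"
    by (auto simp: inner_vec_def sum_2 n)
  show d: "u = (e \<bullet> u) *\<^sub>R e + (n \<bullet> u) *\<^sub>R n"
    unfolding vec_eq_iff forall_2 i
    using 1 by (auto simp: n) algebra+
  show n1: "norm n = 1" using 1 by (simp add: norm_eq_1 inner_vec_def sum_2 power2_eq_square n)
  show en: "e \<bullet> n = 0" by (simp add: inner_vec_def sum_2 n)
  have "(norm u)\<^sup>2 = u $ 1 * u $ 1 + u $ 2 * u $ 2" by (simp add: power2_norm_eq_inner inner_vec_def sum_2)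
  then show "(norm u)\<^sup>2 = (e \<bullet> u)\<^sup>2 + (n \<bullet> u)\<^sup>2" unfolding i using 1 by algebra
qed

text \<open>Take the diameter \<open>[a, b]\<close> of the set, and points \<open>p, q\<close> that are extremal in the direction
  orthogonal to it. The parallelogram of the midpoints of the quadrilateral \<open>a p b q\<close> has sides
  \<open>(b - a) / 2\<close> and \<open>(p - q) / 2\<close>, the first of which is the longer one, so both its heights are
  at least half the width of the strip.\<close>

lemma convex_strip_and_ball:
  fixes \<Omega> :: "pt set"
  assumes "open \<Omega>" "convex \<Omega>" "bounded \<Omega>" "\<Omega> \<noteq> {}"
  obtains n b W z where "norm n = 1" "W > 0" "\<And>x. x \<in> \<Omega> \<Longrightarrow> \<bar>n \<bullet> x - b\<bar> \<le> W / 2" "ball z (W / 4) \<subseteq> \<Omega>"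
proof -
  let ?K = "closure \<Omega>"
  have K: "compact ?K" "?K \<noteq> {}" "convex ?K"
    using assms by (auto simp: compact_closure convex_closure)
  obtain x0 r where r: "r > 0" "ball x0 r \<subseteq> \<Omega>" using assms(1,4) by (meson all_not_in_conv openE)
  have rK: "ball x0 r \<subseteq> ?K" using r(2) closure_subset by blast
  obtain a b where ab: "a \<in> ?K" "b \<in> ?K" "dist a b = diameter ?K"
    using diameter_compact_attained[OF K(1,2)] by blast
  define D where "D = norm (b - a)"
  have D: "norm (x - y) \<le> D" if "x \<in> ?K" "y \<in> ?K" for x y
    using diameter_bounded_bound[OF compact_imp_bounded[OF K(1)] that] ab(3) by (simp add: D_def dist_norm norm_minus_commute)
  have D0: "D > 0"
  proof -
    have "x0 + (r/2) *\<^sub>R axis 1 1 \<in> ?K" "x0 \<in> ?K" using rK r(1) by (auto simp: dist_norm subset_iff)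
    from D[OF this] r(1) show ?thesis by simp
  qed
  define e where "e = (1 / D) *\<^sub>R (b - a)"
  have e: "norm e = 1" using D0 by (simp add: e_def D_def)
  have ba: "b - a = D *\<^sub>R e" using D0 by (simp add: e_def)
  define n :: pt where "n = vector [- e $ 2, e $ 1]"
  note dec = vec2_decomp[OF e n_def]
  have cont: "continuous_on ?K (\<lambda>x. n \<bullet> x)" by (intro continuous_intros)
  obtain p where p: "p \<in> ?K" "\<And>x. x \<in> ?K \<Longrightarrow> n \<bullet> x \<le> n \<bullet> p"
    using continuous_attains_sup[OF K(1,2) cont] by blast
  obtain q where q: "q \<in> ?K" "\<And>x. x \<in> ?K \<Longrightarrow> n \<bullet> q \<le> n \<bullet> x"
    using continuous_attains_inf[OF K(1,2) cont] by blast
  define W where "W = n \<bullet> p - n \<bullet> q"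
  define f where "f = p - q"
  have W: "W > 0"
  proof -
    have "x0 + (r/2) *\<^sub>R n \<in> ?K" "x0 \<in> ?K" using rK r(1) dec(2) by (auto simp: dist_norm subset_iff)
    then have "n \<bullet> (x0 + (r/2) *\<^sub>R n) \<le> n \<bullet> p" "n \<bullet> q \<le> n \<bullet> x0" using p(2) q(2) by auto
    then show ?thesis using r(1) dec(2) by (simp add: W_def inner_add_right dot_square_norm)
  qed
  have nf: "n \<bullet> f = W" by (simp add: f_def W_def inner_diff_right)
  \<comment> \<open>The centre of the parallelogram of midpoints.\<close>
  define z where "z = (1/4) *\<^sub>R (a + b + p + q)"
  have "ball z (W / 4) \<subseteq> ?K"
  proof
    fix x assume "x \<in> ball z (W / 4)"
    define d where "d = x - z"
    have d: "norm d < W / 4" using \<open>x \<in> ball z (W / 4)\<close> by (simp add: d_def dist_norm norm_minus_commute)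
    \<comment> \<open>Coordinates of \<open>d\<close> with respect to the quarter sides
      \<open>(b - a) / 4\<close> and \<open>f / 4\<close>; the parallelogram is the region where
      both are at most 1 in absolute value.\<close>
    define \<beta> where "\<beta> = 4 * (n \<bullet> d) / W"
    define \<alpha> where "\<alpha> = 4 / D * (e \<bullet> d - (e \<bullet> f) / W * (n \<bullet> d))"
    have "\<bar>n \<bullet> d\<bar> \<le> W / 4" using Cauchy_Schwarz_ineq2[of n d] dec(2) d by simp
    then have \<beta>: "\<bar>\<beta>\<bar> \<le> 1" using W by (simp add: \<beta>_def abs_mult field_simps)
    have \<alpha>: "\<bar>\<alpha>\<bar> \<le> 1"
    proof -
      \<comment> \<open>This vector is \<open>f\<close> turned by a right angle, so its length is
        that of \<open>f\<close>, at most the diameter \<open>D\<close>.\<close>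
      have "(norm (W *\<^sub>R e - (e \<bullet> f) *\<^sub>R n))\<^sup>2 = W\<^sup>2 + (e \<bullet> f)\<^sup>2"
        using e dec(2,3) unfolding power2_norm_eq_inner norm_eq_1
        by (simp add: inner_diff inner_commute power2_eq_square)
      also have "\<dots> = (norm f)\<^sup>2" using dec(4)[of f] nf by simp
      finally have "norm (W *\<^sub>R e - (e \<bullet> f) *\<^sub>R n) = norm f" by (simp add: power2_eq_iff_nonneg)
      also have "\<dots> \<le> D" unfolding f_def by (rule D[OF p(1) q(1)])
      finally have le: "norm (W *\<^sub>R e - (e \<bullet> f) *\<^sub>R n) \<le> D" .
      have "\<bar>(W *\<^sub>R e - (e \<bullet> f) *\<^sub>R n) \<bullet> d\<bar> \<le> D * (W / 4)"
        using Cauchy_Schwarz_ineq2[of "W *\<^sub>R e - (e \<bullet> f) *\<^sub>R n" d] mult_mono[OF le less_imp_le[OF d]] D0 by simp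
      moreover have "\<alpha> = 4 / (D * W) * ((W *\<^sub>R e - (e \<bullet> f) *\<^sub>R n) \<bullet> d)"
        using D0 W by (simp add: \<alpha>_def inner_diff_left field_simps)
      ultimately have "\<bar>\<alpha>\<bar> \<le> 4 / (D * W) * (D * (W / 4))"
        using D0 W by (simp only: abs_mult) (intro mult_mono, auto)
      then show ?thesis using D0 W by simp
    qed
    have "d = (\<alpha> / 4) *\<^sub>R (b - a) + (\<beta> / 4) *\<^sub>R f"
    proof -
      have "(\<alpha> / 4) *\<^sub>R (b - a) + (\<beta> / 4) *\<^sub>R f = (\<alpha> * D / 4) *\<^sub>R e + (\<beta> / 4) *\<^sub>R ((e \<bullet> f) *\<^sub>R e + W *\<^sub>R n)"
        using dec(1)[of f] unfolding ba nf by simp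
      also have "\<dots> = (\<alpha> * D / 4 + \<beta> / 4 * (e \<bullet> f)) *\<^sub>R e + (\<beta> / 4 * W) *\<^sub>R n"
        by (simp add: scaleR_add_left scaleR_add_right add.assoc)
      also have "\<alpha> * D / 4 + \<beta> / 4 * (e \<bullet> f) = e \<bullet> d" using D0 W by (simp add: \<alpha>_def \<beta>_def field_simps)
      also have "\<beta> / 4 * W = n \<bullet> d" using W by (simp add: \<beta>_def)
      finally show ?thesis using dec(1)[of d] by simp
    qed
    \<comment> \<open>\<open>x\<close> is the midpoint of a point of the segment from
      \<open>a\<close> to \<open>b\<close> and a point of the segment from \<open>p\<close> to
      \<open>q\<close>.\<close>
    then have "x = (1/2) *\<^sub>R (((1 - \<alpha>) / 2) *\<^sub>R a + ((1 + \<alpha>) / 2) *\<^sub>R b) + (1/2) *\<^sub>R (((1 + \<beta>) / 2) *\<^sub>R p + ((1 - \<beta>) / 2) *\<^sub>R q)"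
      by (simp add: d_def z_def f_def algebra_simps add_divide_distrib diff_divide_distrib)
    moreover have "((1 - \<alpha>) / 2) *\<^sub>R a + ((1 + \<alpha>) / 2) *\<^sub>R b \<in> ?K"
      by (rule convexD[OF K(3) ab(1,2)]) (use \<alpha> in \<open>auto simp: field_simps\<close>)
    moreover have "((1 + \<beta>) / 2) *\<^sub>R p + ((1 - \<beta>) / 2) *\<^sub>R q \<in> ?K"
      by (rule convexD[OF K(3) p(1) q(1)]) (use \<beta> in \<open>auto simp: field_simps\<close>)
    ultimately show "x \<in> ?K" using convexD[OF K(3), of _ _ "1/2" "1/2"] by simp
  qed
  then have "ball z (W / 4) \<subseteq> interior ?K" by (simp add: interior_maximal)
  \<comment> \<open>An open convex set is the interior of its closure, so the closure adds nothing
    here.\<close>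
  then have sub: "ball z (W / 4) \<subseteq> \<Omega>"
    using convex_interior_closure[OF assms(2)] interior_open[OF assms(1)] by simp
  have "\<bar>n \<bullet> x - (n \<bullet> p + n \<bullet> q) / 2\<bar> \<le> W / 2" if "x \<in> \<Omega>" for x
  proof -
    have "x \<in> ?K" using that closure_subset by blast
    with p(2)[OF this] q(2)[OF this] show ?thesis by (simp add: W_def abs_le_iff field_simps)
  qed
  from that[OF dec(2) W this sub] show thesis .
qed

section \<open>An upper bound for the first eigenvalue\<close>

text \<open>For \<open>m \<ge> 2\<close> the difference quotient at the kink is the power
  \<open>m - 1\<close> of \<open>max 0 h\<close>, which tends to 0.\<close>

lemma max_0_power_has_derivative:
  assumes "m \<ge> 2"
  shows "((\<lambda>t::real. (max 0 t) ^ m) has_real_derivative (real m * (max 0 t) ^ (m - 1))) (at t)"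
proof -
  consider "t > 0" | "t < 0" | "t = 0" by linarith
  then show ?thesis
  proof cases
    case 1
    have "((\<lambda>t::real. t ^ m) has_real_derivative real m * t ^ (m - 1)) (at t)"
      by (auto intro!: derivative_eq_intros)
    then have "((\<lambda>t::real. (max 0 t) ^ m) has_real_derivative real m * t ^ (m - 1)) (at t)"
      by (rule has_field_derivative_transform_within_open[where S = "{0<..}"]) (use 1 in auto)
    with 1 show ?thesis by simp
  next
    case 2
    have "((\<lambda>t::real. 0) has_real_derivative 0) (at t)" by simp
    then have "((\<lambda>t::real. (max 0 t) ^ m) has_real_derivative 0) (at t)"
      by (rule has_field_derivative_transform_within_open[where S = "{..<0}"]) (use 2 assms in auto)
    with 2 assms show ?thesis by (simp add: power_0_left)
  next
    case 3
    have "((\<lambda>h::real. (max 0 h) ^ (m - 1)) \<longlongrightarrow> (max 0 0) ^ (m - 1)) (at 0)"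
      by (intro tendsto_intros)
    moreover have "\<forall>\<^sub>F h::real in at 0. (max 0 h) ^ (m - 1) = (max 0 h) ^ m / h"
      unfolding eventually_at_filter
      using assms by (intro always_eventually) (auto simp: max_def power_diff power_0_left)
    ultimately have "((\<lambda>h::real. (max 0 h) ^ m / h) \<longlongrightarrow> (max 0 0) ^ (m - 1)) (at 0)"
      by (rule Lim_transform_eventually)
    with 3 assms show ?thesis by (simp add: has_field_derivative_iff power_0_left)
  qed
qed

text \<open>The affine formula summed over both coordinates; the factor 2 is the dimension.\<close>

lemma integral_by_parts_radial:
  assumes f: "test_fun \<Omega> f"
  shows "(\<integral>x. grad f x \<bullet> (x - z) \<partial>lborel) = - 2 * (\<integral>x. f x \<partial>lborel)"
proof -
  have i: "integrable lborel (\<lambda>x. (axis i 1 \<bullet> x - axis i 1 \<bullet> z) * (grad f x \<bullet> axis i 1))" for i :: 2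
    by (rule test_fun_integrable[OF f, of "\<lambda>x a b. (axis i 1 \<bullet> x - axis i 1 \<bullet> z) * (b \<bullet> axis i 1)"])
       (auto intro!: continuous_intros test_fun_cont_grad[OF f])
  have "(\<integral>x. grad f x \<bullet> (x - z) \<partial>lborel) =
      (\<integral>x. (\<Sum>i\<in>(UNIV::2 set). (axis i 1 \<bullet> x - axis i 1 \<bullet> z) * (grad f x \<bullet> axis i 1)) \<partial>lborel)"
    by (intro Bochner_Integration.integral_cong refl)
       (simp add: sum_2 inner_vec_def axis_def algebra_simps)
  also have "\<dots> = (\<Sum>i\<in>(UNIV::2 set). \<integral>x. (axis i 1 \<bullet> x - axis i 1 \<bullet> z) * (grad f x \<bullet> axis i 1) \<partial>lborel)"
    by (rule Bochner_Integration.integral_sum) (rule i)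
  also have "\<dots> = - 2 * (\<integral>x. f x \<partial>lborel)"
    by (simp add: sum_2 integral_by_parts_affine[OF f] norm_axis_1)
  finally show ?thesis .
qed

text \<open>A truncated paraboloid: powers from the second on are test functions, and integration by
  parts yields their integrals recursively, without polar coordinates.\<close>

definition bump :: "pt \<Rightarrow> real \<Rightarrow> pt \<Rightarrow> real" where
  "bump z R x = max 0 (R\<^sup>2 - (norm (x - z))\<^sup>2)"

lemma bump_eq_0:
  assumes "0 \<le> R" "x \<notin> cball z R"
  shows "bump z R x = 0"
proof -
  have "R < norm (x - z)" using assms(2) by (simp add: dist_norm norm_minus_commute)
  then have "R\<^sup>2 < (norm (x - z))\<^sup>2" using assms(1) by (intro power_strict_mono) auto
  then show ?thesis by (simp add: bump_def)
qed

lemma bump_power_test_fun: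
  assumes m: "m \<ge> 2" and R: "0 \<le> R" "cball z R \<subseteq> \<Omega>"
  shows "test_fun \<Omega> (\<lambda>x. bump z R x ^ m)"
    "grad (\<lambda>x. bump z R x ^ m) = (\<lambda>x. (- 2 * real m * bump z R x ^ (m - 1)) *\<^sub>R (x - z))"
proof -
  have "((\<lambda>x. R\<^sup>2 - (norm (x - z))\<^sup>2) has_derivative (\<lambda>h. - 2 * ((x - z) \<bullet> h))) (at x)" for x
    unfolding power2_norm_eq_inner
    by (rule has_derivative_eq_rhs)
       (auto intro!: derivative_eq_intros simp: inner_commute fun_eq_iff)
  from has_derivative_compose[OF this max_0_power_has_derivative[OF m, unfolded has_field_derivative_def]]
  have D: "((\<lambda>x. bump z R x ^ m) has_derivative
      (\<lambda>h. ((- 2 * real m * bump z R x ^ (m - 1)) *\<^sub>R (x - z)) \<bullet> h)) (at x)" for x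
    by (simp add: bump_def mult_ac)
  have C: "continuous_on UNIV (\<lambda>x. (- 2 * real m * bump z R x ^ (m - 1)) *\<^sub>R (x - z))"
    unfolding bump_def by (intro continuous_intros)
  have z: "bump z R x ^ m = 0" if "x \<notin> cball z R" for x
    using bump_eq_0[OF R(1) that] m by simp
  show "test_fun \<Omega> (\<lambda>x. bump z R x ^ m)"
    "grad (\<lambda>x. bump z R x ^ m) = (\<lambda>x. (- 2 * real m * bump z R x ^ (m - 1)) *\<^sub>R (x - z))"
    using test_funI[OF D C compact_cball R(2) z] by blast+
qed

text \<open>On the support the squared distance is \<open>R^2 - bump z R x\<close>; off it both
  sides vanish, which needs \<open>m > 0\<close>.\<close>

lemma bump_mult: "m > 0 \<Longrightarrow> bump z R x ^ m * (norm (x - z))\<^sup>2 = R\<^sup>2 * bump z R x ^ m - bump z R x ^ (Suc m)"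
  by (cases "R\<^sup>2 - (norm (x - z))\<^sup>2 > 0") (auto simp: bump_def max_def algebra_simps power_0_left)

text \<open>Radial integration by parts of the power \<open>m\<close>, with the squared distance
  eliminated by \<open>bump_mult\<close>.\<close>

lemma bump_power_integral:
  assumes m: "m \<ge> 2" and R: "0 \<le> R"
  shows "real (Suc m) * (\<integral>x. bump z R x ^ m \<partial>lborel) = real m * R\<^sup>2 * (\<integral>x. bump z R x ^ (m - 1) \<partial>lborel)"
proof -
  have int: "integrable lborel (\<lambda>x. bump z R x ^ k)" if "k \<ge> 1" for k
  proof (rule integrable_compact_support[OF compact_cball[of z R]])
    show "continuous_on UNIV (\<lambda>x. bump z R x ^ k)" unfolding bump_def by (intro continuous_intros)
    show "bump z R x ^ k = 0" if "x \<notin> cball z R" for x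
      using bump_eq_0[OF R that] \<open>k \<ge> 1\<close> by (simp add: power_0_left)
  qed
  note t = bump_power_test_fun[OF m R subset_UNIV]
  have "- 2 * (\<integral>x. bump z R x ^ m \<partial>lborel) = (\<integral>x. grad (\<lambda>x. bump z R x ^ m) x \<bullet> (x - z) \<partial>lborel)"
    by (rule integral_by_parts_radial[OF t(1), symmetric])
  also have "\<dots> = (\<integral>x. (- 2 * real m) * (R\<^sup>2 * bump z R x ^ (m - 1) - bump z R x ^ m) \<partial>lborel)"
    unfolding t(2) using m bump_mult[of "m - 1" z R]
    by (intro Bochner_Integration.integral_cong refl) (simp add: dot_square_norm mult.assoc)
  also have "\<dots> = (- 2 * real m) * (R\<^sup>2 * (\<integral>x. bump z R x ^ (m - 1) \<partial>lborel) - (\<integral>x. bump z R x ^ m \<partial>lborel))"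
    using int[of m] int[of "m - 1"] m by simp
  finally show ?thesis by (simp add: algebra_simps)
qed

text \<open>The square of the bump is the trial function. By the recursion its energy is
  \<open>16/3 * I 3\<close> and its squared norm is \<open>I 4 = 4/5 * R^2 * I 3\<close>, with
  quotient \<open>20 / (3 * R^2)\<close>.\<close>

lemma lambda1_le_ball:
  assumes R: "0 < R" "cball z R \<subseteq> \<Omega>"
  shows "lambda1 \<Omega> * R\<^sup>2 \<le> 20 / 3"
proof -
  define I where "I m = (\<integral>x. bump z R x ^ m \<partial>lborel)" for m
  have R0: "0 \<le> R" using R by simp
  note t = bump_power_test_fun[OF order_refl R0 R(2)]
  have i2: "integrable lborel (\<lambda>x. bump z R x ^ 2)"
    using test_fun_integrable_self[OF t(1)] .
  have i3: "integrable lborel (\<lambda>x. bump z R x ^ 3)"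
    by (rule test_fun_integrable_self[OF bump_power_test_fun(1)[OF _ R0 R(2)]]) simp
  have i4: "integrable lborel (\<lambda>x. bump z R x ^ 4)"
    by (rule test_fun_integrable_self[OF bump_power_test_fun(1)[OF _ R0 R(2)]]) simp
  have I: "4 * I 3 = 3 * R\<^sup>2 * I 2" "5 * I 4 = 4 * R\<^sup>2 * I 3"
    using bump_power_integral[of 3 R z] bump_power_integral[of 4 R z] R0 by (auto simp: I_def)
  have "(\<integral>x. (norm (grad (\<lambda>x. bump z R x ^ 2) x))\<^sup>2 \<partial>lborel) = (\<integral>x. 16 * (R\<^sup>2 * bump z R x ^ 2 - bump z R x ^ 3) \<partial>lborel)"
  proof (intro Bochner_Integration.integral_cong refl)
    fix x
    have "(norm (grad (\<lambda>x. bump z R x ^ 2) x))\<^sup>2 = 16 * (bump z R x ^ 2 * (norm (x - z))\<^sup>2)"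
      unfolding t(2) by (simp add: power_mult_distrib)
    then show "(norm (grad (\<lambda>x. bump z R x ^ 2) x))\<^sup>2 = 16 * (R\<^sup>2 * bump z R x ^ 2 - bump z R x ^ 3)"
      using bump_mult[of 2 z R x] by (simp add: numeral_3_eq_3 numeral_2_eq_2)
  qed
  also have "\<dots> = 16 * (R\<^sup>2 * I 2 - I 3)"
    unfolding I_def using i2 i3 by simp
  finally have E: "(\<integral>x. (norm (grad (\<lambda>x. bump z R x ^ 2) x))\<^sup>2 \<partial>lborel) = 16 / 3 * I 3" using I(1) by simp
  have "(\<integral>x. (bump z R x ^ 2)\<^sup>2 \<partial>lborel) = I 4" by (simp add: I_def flip: power_mult)
  with lambda1_le[OF t(1)] E have le: "lambda1 \<Omega> * I 4 \<le> 16 / 3 * I 3" by simp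
  have pos: "I 4 > 0"
  proof (rule ccontr)
    assume "\<not> I 4 > 0"
    moreover have "I 4 \<ge> 0" unfolding I_def by (simp add: bump_def)
    ultimately have "I 4 = 0" by linarith
    then have "(\<integral>x. bump z R x ^ 4 \<partial>lborel) = 0" by (simp add: I_def)
    then have "AE x in lborel. bump z R x ^ 4 = 0"
      by (subst (asm) integral_nonneg_eq_0_iff_AE[OF i4]) (auto simp: bump_def)
    then have "AE x in lborel. x \<notin> ball z R"
    proof eventually_elim
      case (elim x)
      then have "R\<^sup>2 \<le> (norm (x - z))\<^sup>2" by (simp add: bump_def max_def split: if_splits)
      then have "R \<le> norm (x - z)" by (rule power2_le_imp_le) simp
      then show ?case by (simp add: dist_norm norm_minus_commute)
    qed
    then have "emeasure lborel (ball z R) = 0" by (subst (asm) AE_iff_measurable[of "ball z R"]) auto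
    with content_ball_pos[OF R(1), of z] show False by (simp add: measure_def)
  qed
  have "(lambda1 \<Omega> * R\<^sup>2) * I 4 \<le> 16 / 3 * (R\<^sup>2 * I 3)"
    using mult_left_mono[OF le, of "R\<^sup>2"] by (simp add: mult_ac)
  also have "\<dots> = 20 / 3 * I 4" using I(2) by simp
  finally show ?thesis using pos by simp
qed

section \<open>The cubic moment of the torsion function\<close>

lemma mult_abs_has_derivative:
  "((\<lambda>s::real. s * \<bar>s\<bar>) has_real_derivative 2 * \<bar>s\<bar>) (at s)"
proof -
  have eq: "(\<lambda>s::real. s * \<bar>s\<bar>) = (\<lambda>s. (max 0 s)\<^sup>2 - (max 0 (- s))\<^sup>2)"
    by (auto simp: fun_eq_iff max_def power2_eq_square abs_if)
  have d: "((\<lambda>s::real. (max 0 s)\<^sup>2) has_real_derivative 2 * max 0 s) (at s)" for s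
    using max_0_power_has_derivative[of 2 s] by simp
  have "((\<lambda>s::real. (max 0 (- s))\<^sup>2) has_real_derivative (2 * max 0 (- s)) * (- 1)) (at s)"
    by (rule DERIV_chain2[OF d]) (auto intro!: derivative_eq_intros)
  from DERIV_diff[OF d this] show ?thesis
    unfolding eq by (rule DERIV_cong) (auto simp: max_def abs_if)
qed

text \<open>The odd form of the power 3/2, continuously differentiable across 0; approximating test
  functions may change sign.\<close>

lemma sqrt_abs_mult_has_derivative:
  "((\<lambda>s::real. s * sqrt \<bar>s\<bar>) has_real_derivative 3/2 * sqrt \<bar>s\<bar>) (at s)"
proof (cases "s = 0")
  case True
  have "((\<lambda>h::real. sqrt \<bar>h\<bar>) \<longlongrightarrow> sqrt \<bar>0\<bar>) (at 0)" by (intro tendsto_intros)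
  then have "((\<lambda>h::real. (h * sqrt \<bar>h\<bar>) / h) \<longlongrightarrow> sqrt \<bar>0\<bar>) (at 0)"
    by (rule Lim_transform_eventually) (auto simp: eventually_at_filter)
  with True show ?thesis by (simp add: has_field_derivative_iff)
next
  case False
  then consider "s > 0" | "s < 0" by linarith
  then show ?thesis
  proof cases
    case 1
    have "((\<lambda>s::real. s * sqrt s) has_real_derivative 3/2 * sqrt s) (at s)"
      using 1 by (auto intro!: derivative_eq_intros simp: field_simps)
    then have "((\<lambda>s::real. s * sqrt \<bar>s\<bar>) has_real_derivative 3/2 * sqrt s) (at s)"
      by (rule has_field_derivative_transform_within_open[where S = "{0<..}"]) (use 1 in auto)
    with 1 show ?thesis by simp
  next
    case 2
    have "((\<lambda>s::real. s * sqrt (- s)) has_real_derivative 3/2 * sqrt (- s)) (at s)"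
      using 2 by (auto intro!: derivative_eq_intros simp: field_simps)
    then have "((\<lambda>s::real. s * sqrt \<bar>s\<bar>) has_real_derivative 3/2 * sqrt (- s)) (at s)"
      by (rule has_field_derivative_transform_within_open[where S = "{..<0}"]) (use 2 in auto)
    with 2 show ?thesis by simp
  qed
qed

lemma saturation_has_derivative:
  assumes "\<eta> > 0"
  shows "((\<lambda>t::real. t / (1 + \<eta> * \<bar>t\<bar>)) has_real_derivative 1 / (1 + \<eta> * \<bar>t\<bar>)\<^sup>2) (at t)"
proof (cases "t = 0")
  case True
  have "((\<lambda>h::real. 1 / (1 + \<eta> * \<bar>h\<bar>)) \<longlongrightarrow> 1 / (1 + \<eta> * \<bar>0\<bar>)) (at 0)" by (intro tendsto_intros) auto
  then have "((\<lambda>h::real. (h / (1 + \<eta> * \<bar>h\<bar>)) / h) \<longlongrightarrow> 1 / (1 + \<eta> * \<bar>0\<bar>)) (at 0)"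
    by (rule Lim_transform_eventually) (auto simp: eventually_at_filter)
  with True show ?thesis by (simp add: has_field_derivative_iff)
next
  case False
  have p: "1 + \<eta> * \<bar>s\<bar> \<noteq> 0" for s using assms by (smt (verit) mult_nonneg_nonneg abs_ge_zero)
  consider "t > 0" | "t < 0" using False by linarith
  then show ?thesis
  proof cases
    case 1
    have "((\<lambda>t::real. t / (1 + \<eta> * t)) has_real_derivative 1 / (1 + \<eta> * t)\<^sup>2) (at t)"
      using 1 p[of t] by (auto intro!: derivative_eq_intros simp: field_simps power2_eq_square)
    then have "((\<lambda>t::real. t / (1 + \<eta> * \<bar>t\<bar>)) has_real_derivative 1 / (1 + \<eta> * t)\<^sup>2) (at t)"
      by (rule has_field_derivative_transform_within_open[where S = "{0<..}"]) (use 1 in auto)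
    with 1 show ?thesis by simp
  next
    case 2
    have "((\<lambda>t::real. t / (1 - \<eta> * t)) has_real_derivative 1 / (1 - \<eta> * t)\<^sup>2) (at t)"
      using 2 p[of t] by (auto intro!: derivative_eq_intros simp: field_simps power2_eq_square)
    then have "((\<lambda>t::real. t / (1 + \<eta> * \<bar>t\<bar>)) has_real_derivative 1 / (1 - \<eta> * t)\<^sup>2) (at t)"
      by (rule has_field_derivative_transform_within_open[where S = "{..<0}"]) (use 2 in auto)
    with 2 show ?thesis by simp
  qed
qed

text \<open>For a smooth positive torsion function, testing \<open>lambda1\<close> with \<open>v powr (3/2)\<close> and the torsion
  equation with \<open>9/8 * v\<^sup>2\<close> gives \<open>lambda1 * \<integral> v\<^sup>3 \<le> 9/8 * \<integral> v\<^sup>2\<close>. Composing both powers with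
  \<open>\<sigma> t = t / (1 + \<eta> * \<bar>t\<bar>)\<close> keeps their derivatives bounded, so the argument runs on the
  approximating test functions, with an error that vanishes along the sequence.\<close>

lemma lambda1_saturated_le:
  assumes \<eta>: "\<eta> > 0" and tor: "torsion_sol \<Omega> v g" and \<phi>: "test_fun \<Omega> \<phi>" and Lg: "L2 lborel g"
  shows "lambda1 \<Omega> * (\<integral>x. \<bar>\<phi> x / (1 + \<eta> * \<bar>\<phi> x\<bar>)\<bar> ^ 3 \<partial>lborel) \<le>
      9/8 * (\<integral>x. (\<phi> x)\<^sup>2 \<partial>lborel) +
      sqrt ((\<integral>x. (norm (grad \<phi> x - g x))\<^sup>2 \<partial>lborel) * ((9 / (4 * \<eta>))\<^sup>2 * (\<integral>x. (norm (grad \<phi> x))\<^sup>2 \<partial>lborel)))"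
proof -
  define \<sigma> where "\<sigma> t = t / (1 + \<eta> * \<bar>t\<bar>)" for t :: real
  define \<sigma>' where "\<sigma>' t = 1 / (1 + \<eta> * \<bar>t\<bar>)\<^sup>2" for t :: real
  have p: "1 + \<eta> * \<bar>t\<bar> \<ge> 1" for t using \<eta> by simp
  have p0: "1 + \<eta> * \<bar>t\<bar> \<noteq> 0" for t using p[of t] by linarith
  have \<sigma>0: "\<sigma> 0 = 0" by (simp add: \<sigma>_def)
  have d\<sigma>: "(\<sigma> has_real_derivative \<sigma>' t) (at t)" for t
    unfolding \<sigma>_def \<sigma>'_def by (rule saturation_has_derivative[OF \<eta>])
  have c\<sigma>: "continuous_on UNIV \<sigma>" "continuous_on UNIV \<sigma>'"
    unfolding \<sigma>_def \<sigma>'_def using p0 by (auto intro!: continuous_intros)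
  have \<sigma>'1: "0 \<le> \<sigma>' t" "\<sigma>' t \<le> 1" for t
    unfolding \<sigma>'_def using p[of t] by (auto simp: divide_le_eq_1 one_le_power)
  have \<sigma>b: "\<bar>\<sigma> t\<bar> \<le> 1 / \<eta>" "\<bar>\<sigma> t\<bar> \<le> \<bar>t\<bar>" for t
  proof -
    have a: "\<bar>\<sigma> t\<bar> = \<bar>t\<bar> / (1 + \<eta> * \<bar>t\<bar>)" 
      unfolding \<sigma>_def abs_divide by (simp only: abs_of_nonneg[OF order_trans[OF zero_le_one p]])
    show "\<bar>\<sigma> t\<bar> \<le> 1 / \<eta>" 
    proof -
      have "1 + \<eta> * \<bar>t\<bar> > 0" using p[of t] by linarith
      then show ?thesis unfolding a using \<eta> by (simp only: pos_divide_le_eq) (simp add: field_simps)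
    qed
    show "\<bar>\<sigma> t\<bar> \<le> \<bar>t\<bar>" unfolding a using divide_left_mono[of 1 "1 + \<eta> * \<bar>t\<bar>" "\<bar>t\<bar>"] p[of t] by simp
  qed
  \<comment> \<open>\<open>f\<close> saturates the power 3/2 and \<open>H\<close> saturates 9/8
    times the square. The constant 9/8 gives \<open>(f')^2 \<le> H'\<close>, since both carry the
    factor \<open>9/4 * \<bar>\<sigma>\<bar>\<close> and \<open>\<sigma>' \<le> 1\<close>.\<close>
  define f where "f t = \<sigma> t * sqrt \<bar>\<sigma> t\<bar>" for t
  define f' where "f' t = 3/2 * sqrt \<bar>\<sigma> t\<bar> * \<sigma>' t" for t
  define H where "H t = 9/8 * (\<sigma> t * \<bar>\<sigma> t\<bar>)" for t
  define H' where "H' t = 9/8 * (2 * \<bar>\<sigma> t\<bar> * \<sigma>' t)" for t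
  have df: "(f has_real_derivative f' t) (at t)" for t
    unfolding f_def f'_def by (rule DERIV_chain2[OF sqrt_abs_mult_has_derivative d\<sigma>])
  have dH: "(H has_real_derivative H' t) (at t)" for t
    unfolding H_def H'_def by (intro DERIV_cmult DERIV_chain2[OF mult_abs_has_derivative d\<sigma>])
  have cf: "continuous_on UNIV f'" and cH: "continuous_on UNIV H'"
    unfolding f'_def H'_def by (intro continuous_intros c\<sigma>)+
  note tf = test_fun_compose[OF \<phi> df cf] and tH = test_fun_compose[OF \<phi> dH cH]
  have f0: "f 0 = 0" and H0: "H 0 = 0" by (auto simp: f_def H_def \<sigma>0)
  note tf = tf[OF f0] and tH = tH[OF H0]
  have fH: "(f' t)\<^sup>2 \<le> H' t" for t
  proof -
    have "(f' t)\<^sup>2 = 9/4 * \<bar>\<sigma> t\<bar> * (\<sigma>' t * \<sigma>' t)"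
      by (simp add: f'_def power_mult_distrib power2_eq_square)
    also have "\<dots> \<le> 9/4 * \<bar>\<sigma> t\<bar> * (\<sigma>' t * 1)"
      using \<sigma>'1[of t] by (intro mult_left_mono) auto
    finally show ?thesis by (simp add: H'_def mult_ac)
  qed
  \<comment> \<open>This bound, available only through the saturation, is the constant in the error
    term.\<close>
  have H'b: "\<bar>H' t\<bar> \<le> 9 / (4 * \<eta>)" for t
  proof -
    have "\<bar>\<sigma> t\<bar> * \<sigma>' t \<le> (1 / \<eta>) * 1" using \<sigma>b(1)[of t] \<sigma>'1[of t] \<eta> by (intro mult_mono) auto
    then have "9/4 * (\<bar>\<sigma> t\<bar> * \<sigma>' t) \<le> 9 / (4 * \<eta>)" by simp
    moreover have "\<bar>H' t\<bar> = 9/4 * (\<bar>\<sigma> t\<bar> * \<sigma>' t)" using \<sigma>'1(1)[of t] by (simp add: H'_def abs_mult)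
    ultimately show ?thesis by simp
  qed
  have Hb: "H t \<le> 9/8 * t\<^sup>2" for t
  proof -
    have "\<sigma> t * \<bar>\<sigma> t\<bar> \<le> \<bar>\<sigma> t\<bar> * \<bar>\<sigma> t\<bar>" by (intro mult_right_mono) auto
    also have "\<dots> \<le> \<bar>t\<bar> * \<bar>t\<bar>" by (intro mult_mono \<sigma>b) auto
    finally show ?thesis by (simp add: H_def power2_eq_square)
  qed
  have f_sq: "(f t)\<^sup>2 = \<bar>\<sigma> t\<bar> ^ 3" for t
    by (simp add: f_def power_mult_distrib power3_eq_cube power2_eq_square)
  let ?w = "grad (\<lambda>x. H (\<phi> x))"
  note L\<phi> = test_fun_grad_L2[OF \<phi>] and Lw = test_fun_grad_L2[OF tH(1)]
  have "lambda1 \<Omega> * (\<integral>x. \<bar>\<sigma> (\<phi> x)\<bar> ^ 3 \<partial>lborel) = lambda1 \<Omega> * (\<integral>x. (f (\<phi> x))\<^sup>2 \<partial>lborel)"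
    by (simp add: f_sq)
  also have "\<dots> \<le> (\<integral>x. (norm (grad (\<lambda>x. f (\<phi> x)) x))\<^sup>2 \<partial>lborel)"
    by (rule lambda1_le[OF tf(1)])
  also have "\<dots> \<le> (\<integral>x. grad \<phi> x \<bullet> ?w x \<partial>lborel)"
  proof (rule integral_mono)
    show "integrable lborel (\<lambda>x. (norm (grad (\<lambda>x. f (\<phi> x)) x))\<^sup>2)"
      by (rule L2_integrable_norm[OF test_fun_grad_L2[OF tf(1)]])
    show "integrable lborel (\<lambda>x. grad \<phi> x \<bullet> ?w x)" by (rule L2_inner_integrable[OF L\<phi> Lw])
    show "(norm (grad (\<lambda>x. f (\<phi> x)) x))\<^sup>2 \<le> grad \<phi> x \<bullet> ?w x" for x
      unfolding tf(2) tH(2) using mult_right_mono[OF fH[of "\<phi> x"], of "(norm (grad \<phi> x))\<^sup>2"]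
      by (simp add: power_mult_distrib dot_square_norm)
  qed
  \<comment> \<open>The torsion equation holds for \<open>g\<close>, not for
    \<open>grad \<phi>\<close>; the discrepancy is the error term.\<close>
  also have "\<dots> = (\<integral>x. (grad \<phi> x - g x) \<bullet> ?w x \<partial>lborel) + (\<integral>x. g x \<bullet> ?w x \<partial>lborel)"
    using L2_inner_integrable[OF L2_diff[OF L\<phi> Lg] Lw] L2_inner_integrable[OF Lg Lw]
    by (subst Bochner_Integration.integral_add[symmetric]) (auto simp: inner_diff_left)
  also have "(\<integral>x. g x \<bullet> ?w x \<partial>lborel) = (\<integral>x. H (\<phi> x) \<partial>lborel)"
    using tor tH(1) by (simp add: torsion_sol_def)
  also have "\<dots> \<le> (\<integral>x. 9/8 * (\<phi> x)\<^sup>2 \<partial>lborel)"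
    using test_fun_integrable_self[OF tH(1)] L2_integrable_norm[OF test_fun_L2[OF \<phi>]] Hb
    by (intro integral_mono) auto
  also have "\<dots> = 9/8 * (\<integral>x. (\<phi> x)\<^sup>2 \<partial>lborel)" by simp
  also have "(\<integral>x. (grad \<phi> x - g x) \<bullet> ?w x \<partial>lborel) \<le>
      sqrt ((\<integral>x. (norm (grad \<phi> x - g x))\<^sup>2 \<partial>lborel) * ((9 / (4 * \<eta>))\<^sup>2 * (\<integral>x. (norm (grad \<phi> x))\<^sup>2 \<partial>lborel)))"
  proof (rule real_le_rsqrt)
    have "(\<integral>x. (norm (?w x))\<^sup>2 \<partial>lborel) \<le> (\<integral>x. (9 / (4 * \<eta>))\<^sup>2 * (norm (grad \<phi> x))\<^sup>2 \<partial>lborel)"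
    proof (rule integral_mono)
      show "integrable lborel (\<lambda>x. (norm (?w x))\<^sup>2)" by (rule L2_integrable_norm[OF Lw])
      show "integrable lborel (\<lambda>x. (9 / (4 * \<eta>))\<^sup>2 * (norm (grad \<phi> x))\<^sup>2)"
        using L2_integrable_norm[OF L\<phi>] by simp
      show "(norm (?w x))\<^sup>2 \<le> (9 / (4 * \<eta>))\<^sup>2 * (norm (grad \<phi> x))\<^sup>2" for x
        unfolding tH(2) norm_scaleR power_mult_distrib
        by (intro mult_right_mono power_mono H'b) auto
    qed
    then have w: "(\<integral>x. (norm (?w x))\<^sup>2 \<partial>lborel) \<le> (9 / (4 * \<eta>))\<^sup>2 * (\<integral>x. (norm (grad \<phi> x))\<^sup>2 \<partial>lborel)"
      by (simp only: integral_mult_right_zero)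
    have "(\<integral>x. (grad \<phi> x - g x) \<bullet> ?w x \<partial>lborel)\<^sup>2 \<le>
        (\<integral>x. (norm (grad \<phi> x - g x))\<^sup>2 \<partial>lborel) * (\<integral>x. (norm (?w x))\<^sup>2 \<partial>lborel)"
      by (rule L2_Cauchy_Schwarz[OF L2_diff[OF L\<phi> Lg] Lw])
    also have "\<dots> \<le> (\<integral>x. (norm (grad \<phi> x - g x))\<^sup>2 \<partial>lborel) * ((9 / (4 * \<eta>))\<^sup>2 * (\<integral>x. (norm (grad \<phi> x))\<^sup>2 \<partial>lborel))"
      by (intro mult_left_mono w) simp
    finally show "(\<integral>x. (grad \<phi> x - g x) \<bullet> ?w x \<partial>lborel)\<^sup>2 \<le> \<dots>" .
  qed
  finally show ?thesis by (simp add: \<sigma>_def)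
qed

text \<open>Two limits, both by Fatou's lemma: first \<open>\<phi> n\<close> tends to
  \<open>v\<close> with \<open>\<eta>\<close> fixed, which kills the error term, then
  \<open>\<eta>\<close> tends to 0 in a bound that no longer depends on it.\<close>

lemma torsion_L3_bound:
  assumes tor: "torsion_sol \<Omega> v g" and lam: "lambda1 \<Omega> > 0"
  shows "integrable lborel (\<lambda>x. \<bar>v x\<bar> ^ 3)"
    "lambda1 \<Omega> * (\<integral>x. \<bar>v x\<bar> ^ 3 \<partial>lborel) \<le> 9/8 * (\<integral>x. (v x)\<^sup>2 \<partial>lborel)"
proof -
  obtain \<phi> where \<phi>: "\<And>n. test_fun \<Omega> (\<phi> n)" "L2 lborel v" "L2 lborel g"
    "(\<lambda>n. \<integral>x. (norm (\<phi> n x - v x))\<^sup>2 \<partial>lborel) \<longlonglongrightarrow> 0"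
    "(\<lambda>n. \<integral>x. (norm (grad (\<phi> n) x - g x))\<^sup>2 \<partial>lborel) \<longlonglongrightarrow> 0"
    by (rule in_H01_E[OF torsion_sol_in_H01[OF tor]]) (rule that)
  have [measurable]: "v \<in> borel_measurable lborel" "\<And>n. \<phi> n \<in> borel_measurable lborel"
    using L2_measurable[OF \<phi>(2)] L2_measurable[OF test_fun_L2[OF \<phi>(1)]] by auto
  \<comment> \<open>Fatou's lemma needs convergence almost everywhere, which norm convergence gives
    along a subsequence.\<close>
  have "\<exists>r::nat\<Rightarrow>nat. strict_mono r \<and> (AE x in lborel. (\<lambda>n. (norm (\<phi> (r n) x - v x))\<^sup>2) \<longlonglongrightarrow> 0)"
    by (rule tendsto_L1_AE_subseq)
       (use L2_integrable_norm[OF L2_diff[OF test_fun_L2[OF \<phi>(1)] \<phi>(2)]] \<phi>(4) in auto)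
  then obtain r :: "nat \<Rightarrow> nat" where r: "strict_mono r" "AE x in lborel. (\<lambda>n. (norm (\<phi> (r n) x - v x))\<^sup>2) \<longlonglongrightarrow> 0"
    by blast
  have ae: "AE x in lborel. (\<lambda>n. \<phi> (r n) x) \<longlonglongrightarrow> v x"
    using r(2)
  proof eventually_elim
    case (elim x)
    then have "(\<lambda>n. \<phi> (r n) x - v x) \<longlonglongrightarrow> 0" by simp
    then show ?case by (simp add: LIM_zero_iff)
  qed
  let ?N = "\<integral>x. (v x)\<^sup>2 \<partial>lborel" and ?E = "\<integral>x. (norm (g x))\<^sup>2 \<partial>lborel"
  have N: "(\<lambda>n. \<integral>x. (\<phi> (r n) x)\<^sup>2 \<partial>lborel) \<longlonglongrightarrow> ?N"
    using LIMSEQ_subseq_LIMSEQ[OF L2_tendsto_norm[OF test_fun_L2[OF \<phi>(1)] \<phi>(2,4)] r(1)] by (simp add: o_def)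
  have E: "(\<lambda>n. \<integral>x. (norm (grad (\<phi> (r n)) x))\<^sup>2 \<partial>lborel) \<longlonglongrightarrow> ?E"
    using LIMSEQ_subseq_LIMSEQ[OF L2_tendsto_norm[OF test_fun_grad_L2[OF \<phi>(1)] \<phi>(3,5)] r(1)] by (simp add: o_def)
  have D: "(\<lambda>n. \<integral>x. (norm (grad (\<phi> (r n)) x - g x))\<^sup>2 \<partial>lborel) \<longlonglongrightarrow> 0"
    using LIMSEQ_subseq_LIMSEQ[OF \<phi>(5) r(1)] by (simp add: o_def)
  have sat: "(\<integral>\<^sup>+ x. ennreal (\<bar>v x / (1 + \<eta> * \<bar>v x\<bar>)\<bar> ^ 3) \<partial>lborel) \<le> ennreal (9/8 * ?N / lambda1 \<Omega>)"
    if \<eta>: "\<eta> > 0" for \<eta>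
  proof (rule nn_integral_limit_le)
    define b where "b n = (9/8 * (\<integral>x. (\<phi> (r n) x)\<^sup>2 \<partial>lborel) + sqrt ((\<integral>x. (norm (grad (\<phi> (r n)) x - g x))\<^sup>2 \<partial>lborel) *
        ((9 / (4 * \<eta>))\<^sup>2 * (\<integral>x. (norm (grad (\<phi> (r n)) x))\<^sup>2 \<partial>lborel)))) / lambda1 \<Omega>" for n
    have p: "1 + \<eta> * \<bar>t\<bar> \<noteq> 0" for t using \<eta> by (smt (verit) mult_nonneg_nonneg abs_ge_zero)
    have "b \<longlonglongrightarrow> (9/8 * ?N + sqrt (0 * ((9 / (4 * \<eta>))\<^sup>2 * ?E))) / lambda1 \<Omega>"
      unfolding b_def using lam by (intro tendsto_intros N D E) auto
    then show "b \<longlonglongrightarrow> 9/8 * ?N / lambda1 \<Omega>" by simp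
    show "AE x in lborel. (\<lambda>n. \<bar>\<phi> (r n) x / (1 + \<eta> * \<bar>\<phi> (r n) x\<bar>)\<bar> ^ 3) \<longlonglongrightarrow> \<bar>v x / (1 + \<eta> * \<bar>v x\<bar>)\<bar> ^ 3"
      using ae by eventually_elim (intro tendsto_intros p)
    fix n
    have i: "integrable lborel (\<lambda>x. \<bar>\<phi> (r n) x / (1 + \<eta> * \<bar>\<phi> (r n) x\<bar>)\<bar> ^ 3)"
      by (rule test_fun_integrable[OF \<phi>(1), of "\<lambda>x a b. \<bar>a / (1 + \<eta> * \<bar>a\<bar>)\<bar> ^ 3"])
         (auto intro!: continuous_intros test_fun_cont[OF \<phi>(1)] simp: p)
    have "(\<integral>x. \<bar>\<phi> (r n) x / (1 + \<eta> * \<bar>\<phi> (r n) x\<bar>)\<bar> ^ 3 \<partial>lborel) \<le> b n"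
      using lambda1_saturated_le[OF \<eta> tor \<phi>(1) \<phi>(3), of "r n"] lam
      by (simp only: b_def pos_le_divide_eq mult.commute[of _ "lambda1 \<Omega>"])
    then show "(\<integral>\<^sup>+ x. ennreal (\<bar>\<phi> (r n) x / (1 + \<eta> * \<bar>\<phi> (r n) x\<bar>)\<bar> ^ 3) \<partial>lborel) \<le> ennreal (b n)"
      using i by (subst nn_integral_eq_integral) (auto intro: ennreal_leI)
  qed measurable
  have le: "(\<integral>\<^sup>+ x. ennreal (\<bar>v x\<bar> ^ 3) \<partial>lborel) \<le> ennreal (9/8 * ?N / lambda1 \<Omega>)"
  proof (rule nn_integral_limit_le)
    define \<eta> where "\<eta> k = 1 / real (Suc k)" for k
    have \<eta>: "\<eta> k > 0" for k by (simp add: \<eta>_def)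
    have \<eta>0: "\<eta> \<longlonglongrightarrow> 0" unfolding \<eta>_def by (rule LIMSEQ_Suc[OF lim_1_over_n])
    show "(\<integral>\<^sup>+ x. ennreal (\<bar>v x / (1 + \<eta> k * \<bar>v x\<bar>)\<bar> ^ 3) \<partial>lborel) \<le> ennreal (9/8 * ?N / lambda1 \<Omega>)" for k
      by (rule sat[OF \<eta>])
    show "AE x in lborel. (\<lambda>k. \<bar>v x / (1 + \<eta> k * \<bar>v x\<bar>)\<bar> ^ 3) \<longlonglongrightarrow> \<bar>v x\<bar> ^ 3"
    proof (intro AE_I2)
      fix x
      have "(\<lambda>k. \<bar>v x / (1 + \<eta> k * \<bar>v x\<bar>)\<bar> ^ 3) \<longlonglongrightarrow> \<bar>v x / (1 + 0 * \<bar>v x\<bar>)\<bar> ^ 3"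
        by (intro tendsto_intros \<eta>0) auto
      then show "(\<lambda>k. \<bar>v x / (1 + \<eta> k * \<bar>v x\<bar>)\<bar> ^ 3) \<longlonglongrightarrow> \<bar>v x\<bar> ^ 3" by simp
    qed
  qed auto
  show i: "integrable lborel (\<lambda>x. \<bar>v x\<bar> ^ 3)"
    by (rule integrableI_nonneg) (use le in \<open>auto intro: le_less_trans\<close>)
  from le have "(\<integral>x. \<bar>v x\<bar> ^ 3 \<partial>lborel) \<le> 9/8 * ?N / lambda1 \<Omega>"
    by (subst (asm) nn_integral_eq_integral[OF i]) (auto simp: ennreal_le_iff lam less_imp_le)
  then show "lambda1 \<Omega> * (\<integral>x. \<bar>v x\<bar> ^ 3 \<partial>lborel) \<le> 9/8 * ?N"
    using lam by (simp add: pos_le_divide_eq mult.commute)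
qed

section \<open>The main estimate\<close>

text \<open>Limits of the corresponding facts for test functions; \<open>T\<close>, the energy of
  \<open>g\<close>, takes the place of the integral of \<open>v\<close>.\<close>

lemma torsion_integral_inequalities:
  assumes tor: "torsion_sol \<Omega> v g" and \<Omega>: "\<Omega> \<in> sets lborel" "emeasure lborel \<Omega> < \<infinity>"
    and n: "norm n = 1" and B: "\<forall>x\<in>\<Omega>. \<bar>n \<bullet> x - b\<bar> \<le> B"
  defines "N \<equiv> \<integral>x. (v x)\<^sup>2 \<partial>lborel" and "T \<equiv> \<integral>x. (norm (g x))\<^sup>2 \<partial>lborel"
  shows "lambda1 \<Omega> * N \<le> T" "T\<^sup>2 \<le> measure lborel \<Omega> * N"
    "\<And>c. (c * T - N / 2)\<^sup>2 \<le> (N - 2 * c * T + c\<^sup>2 * measure lborel \<Omega>) * (B\<^sup>2 * T)"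
    "AE x in lborel. x \<notin> \<Omega> \<longrightarrow> v x = 0"
proof -
  obtain \<phi> where \<phi>: "\<And>n. test_fun \<Omega> (\<phi> n)" "L2 lborel v" "L2 lborel g"
    "(\<lambda>n. \<integral>x. (norm (\<phi> n x - v x))\<^sup>2 \<partial>lborel) \<longlonglongrightarrow> 0"
    "(\<lambda>n. \<integral>x. (norm (grad (\<phi> n) x - g x))\<^sup>2 \<partial>lborel) \<longlonglongrightarrow> 0"
    by (rule in_H01_E[OF torsion_sol_in_H01[OF tor]]) (rule that)
  have N: "(\<lambda>n. \<integral>x. (\<phi> n x)\<^sup>2 \<partial>lborel) \<longlonglongrightarrow> N"
    using L2_tendsto_norm[OF test_fun_L2[OF \<phi>(1)] \<phi>(2,4)] by (simp add: N_def)
  have E: "(\<lambda>n. \<integral>x. (norm (grad (\<phi> n) x))\<^sup>2 \<partial>lborel) \<longlonglongrightarrow> T"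
    using L2_tendsto_norm[OF test_fun_grad_L2[OF \<phi>(1)] \<phi>(3,5)] by (simp add: T_def)
  \<comment> \<open>By the torsion equation the integral of \<open>\<phi> n\<close> is the inner
    product of \<open>g\<close> with its gradient, which tends to the energy of
    \<open>g\<close>.\<close>
  have t: "(\<lambda>n. \<integral>x. \<phi> n x \<partial>lborel) \<longlonglongrightarrow> T"
  proof -
    have "(\<lambda>n. \<integral>x. g x \<bullet> grad (\<phi> n) x \<partial>lborel) \<longlonglongrightarrow> (\<integral>x. g x \<bullet> g x \<partial>lborel)"
      by (rule L2_tendsto_inner[OF \<phi>(3,3) _ test_fun_grad_L2[OF \<phi>(1)] \<phi>(3,5)]) simp
    then show ?thesis using tor \<phi>(1) by (simp add: torsion_sol_def T_def dot_square_norm)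
  qed
  show "lambda1 \<Omega> * N \<le> T"
    by (rule LIMSEQ_le[OF tendsto_mult[OF tendsto_const N] E]) (use lambda1_le[OF \<phi>(1)] in auto)
  show "T\<^sup>2 \<le> measure lborel \<Omega> * N"
    by (rule LIMSEQ_le[OF tendsto_power[OF t] tendsto_mult[OF tendsto_const N]])
       (use integral_test_fun_square_le[OF \<phi>(1) \<Omega>] in blast)
  show "(c * T - N / 2)\<^sup>2 \<le> (N - 2 * c * T + c\<^sup>2 * measure lborel \<Omega>) * (B\<^sup>2 * T)" for c
  proof (rule LIMSEQ_le)
    show "(\<lambda>k. (c * (\<integral>x. \<phi> k x \<partial>lborel) - (\<integral>x. (\<phi> k x)\<^sup>2 \<partial>lborel) / 2)\<^sup>2) \<longlonglongrightarrow> (c * T - N / 2)\<^sup>2"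
      by (intro tendsto_intros t N) auto
    show "(\<lambda>k. ((\<integral>x. (\<phi> k x)\<^sup>2 \<partial>lborel) - 2 * c * (\<integral>x. \<phi> k x \<partial>lborel) + c\<^sup>2 * measure lborel \<Omega>) *
         (B\<^sup>2 * (\<integral>x. (norm (grad (\<phi> k) x))\<^sup>2 \<partial>lborel))) \<longlonglongrightarrow> (N - 2 * c * T + c\<^sup>2 * measure lborel \<Omega>) * (B\<^sup>2 * T)"
      by (intro tendsto_intros t N E)
  qed (use strip_inequality[OF \<phi>(1) \<Omega> n bspec[OF B]] in blast)
  show "AE x in lborel. x \<notin> \<Omega> \<longrightarrow> v x = 0"
  proof -
    let ?u = "\<lambda>x. indicator (- \<Omega>) x * v x"
    have [measurable]: "\<Omega> \<in> sets lborel" "v \<in> borel_measurable lborel"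
      using \<Omega> L2_measurable[OF \<phi>(2)] by auto
    have iv: "integrable lborel (\<lambda>x. (norm (v x))\<^sup>2)" by (rule L2_integrable_norm[OF \<phi>(2)])
    have i: "integrable lborel (\<lambda>x. (?u x)\<^sup>2)"
      by (rule Bochner_Integration.integrable_bound[OF iv]) (auto simp: indicator_def)
    \<comment> \<open>Off \<open>\<Omega>\<close> each \<open>\<phi> k\<close> vanishes, so there
      \<open>v\<close> is its own approximation error.\<close>
    have "(\<integral>x. (?u x)\<^sup>2 \<partial>lborel) \<le> (\<integral>x. (norm (\<phi> k x - v x))\<^sup>2 \<partial>lborel)" for k
    proof (rule integral_mono[OF i L2_integrable_norm[OF L2_diff[OF test_fun_L2[OF \<phi>(1)] \<phi>(2)]]])
      fix x
      obtain K where K: "K \<subseteq> \<Omega>" "\<And>x. x \<notin> K \<Longrightarrow> \<phi> k x = 0" using test_fun_support[OF \<phi>(1)] by metis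
      show "(?u x)\<^sup>2 \<le> (norm (\<phi> k x - v x))\<^sup>2"
      proof (cases "x \<in> \<Omega>")
        case False
        then have "\<phi> k x = 0" using K by blast
        with False show ?thesis by simp
      qed simp
    qed
    then have "(\<integral>x. (?u x)\<^sup>2 \<partial>lborel) \<le> 0"
      by (intro LIMSEQ_le[OF tendsto_const \<phi>(4)]) blast
    then have "(\<integral>x. (?u x)\<^sup>2 \<partial>lborel) = 0" by (intro antisym) auto
    then have "AE x in lborel. (?u x)\<^sup>2 = 0"
      by (subst (asm) integral_nonneg_eq_0_iff_AE[OF i]) auto
    then show ?thesis by eventually_elim auto
  qed
qed

text \<open>The conclusion is a strict form of \<open>l\<^sup>2 * N \<le> A\<close>, which already follows from \<open>1\<close> and \<open>2\<close>.\<close>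

lemma deficit_arithmetic:
  fixes l N T A W :: real
  assumes pos: "l > 0" "A > 0" "N \<ge> 0"
    and 1: "l * N \<le> T" and 2: "T\<^sup>2 \<le> A * N"
    and 3: "(T / A * T - N / 2)\<^sup>2 \<le> (N - 2 * (T / A) * T + (T / A)\<^sup>2 * A) * ((W / 2)\<^sup>2 * T)"
    and 4: "l * W\<^sup>2 \<le> 500 / 3"
  shows "l\<^sup>2 * N \<le> (997/1000) * A"
proof (rule ccontr)
  assume "\<not> l\<^sup>2 * N \<le> (997/1000) * A"
  then have c: "l\<^sup>2 * N > (997/1000) * A" by simp
  then have "N \<noteq> 0" using pos by auto
  then have N: "N > 0" using pos by simp
  \<comment> \<open>With \<open>T\<close> as the integral of \<open>v\<close>, the mean is
    \<open>T / A\<close> and \<open>N - X\<close> is the integrated variance.\<close>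
  define X where "X = T\<^sup>2 / A"
  have XN: "X \<le> N" using 2 pos by (simp add: X_def pos_divide_le_eq mult.commute)
  have T0: "T > 0" using 1 mult_pos_pos[OF pos(1) N] by simp
  have "(997/1000) * A * N \<le> l\<^sup>2 * N * N" using c N by (intro mult_right_mono) auto
  also have "\<dots> = (l * N)\<^sup>2" by (simp add: power2_eq_square)
  also have "\<dots> \<le> T\<^sup>2" using 1 pos N by (intro power_mono) auto
  finally have X: "X \<ge> (997/1000) * N" using pos by (simp add: X_def pos_le_divide_eq mult_ac)
  \<comment> \<open>Here 1.002 is a convenient upper bound for the square root of 1000/997.\<close>
  have T: "T \<le> (1002/1000) * (l * N)"
  proof (rule power2_le_imp_le)
    have "(997/1000) * T\<^sup>2 \<le> (997/1000) * A * N" using 2 by simp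
    also have "\<dots> \<le> (l * N)\<^sup>2" using \<open>(997/1000) * A * N \<le> l\<^sup>2 * N * N\<close> by (simp add: power2_eq_square mult_ac)
    finally have "T\<^sup>2 \<le> 1000/997 * (l * N)\<^sup>2" by simp
    also have "\<dots> \<le> (1004004/1000000) * (l * N)\<^sup>2" using zero_le_power2[of "l * N"] by linarith
    also have "\<dots> = ((1002/1000) * (l * N))\<^sup>2" by (simp add: power2_eq_square)
    finally show "T\<^sup>2 \<le> ((1002/1000) * (l * N))\<^sup>2" .
  qed (use pos N in auto)
  have eq: "T / A * T = X" "N - 2 * (T / A) * T + (T / A)\<^sup>2 * A = N - X"
    using pos by (auto simp: X_def power2_eq_square)
  \<comment> \<open>The left side of hypothesis \<open>3\<close> is at least 0.497 squared times
    \<open>N^2\<close>; the right side is at most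
    \<open>0.003 * 1.002 / 4 * 500 / 3 = 0.12525\<close> times \<open>N^2\<close>.\<close>
  have "(247009/1000000) * N\<^sup>2 = ((497/1000) * N)\<^sup>2" by (simp add: power2_eq_square)
  also have "\<dots> \<le> (X - N / 2)\<^sup>2" using X N by (intro power_mono) auto
  also have "\<dots> \<le> (N - X) * ((W / 2)\<^sup>2 * T)" using 3 unfolding eq .
  also have "\<dots> \<le> ((3/1000) * N) * ((W / 2)\<^sup>2 * ((1002/1000) * (l * N)))"
    using X XN T T0 N by (intro mult_mono) auto
  also have "\<dots> = (3/1000) * (1002/1000) / 4 * N\<^sup>2 * (l * W\<^sup>2)" by (simp add: power2_eq_square)
  also have "\<dots> \<le> (3/1000) * (1002/1000) / 4 * N\<^sup>2 * (500 / 3)" using 4 by (intro mult_left_mono) auto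
  finally have "(247009/1000000) * N\<^sup>2 \<le> (12525/100000) * N\<^sup>2" by simp
  moreover have "N\<^sup>2 > 0" using N by simp
  ultimately show False by linarith
qed

text \<open>Weighted arithmetic-geometric mean of \<open>x^2\<close> and 1, interpolating between
  the exponents 0 and 2.\<close>

lemma powr_le_mix_low:
  fixes x p :: real
  assumes "x \<ge> 0" "1 \<le> p" "p \<le> 2"
  shows "x powr p \<le> (1 - p / 2) + p / 2 * x\<^sup>2"
proof (cases "x = 0")
  case False
  then have x: "x > 0" using assms by simp
  have "(x\<^sup>2) powr (p / 2) * 1 powr (1 - p / 2) \<le> p / 2 * x\<^sup>2 + (1 - p / 2) * 1"
    by (rule Youngs_inequality_0) (use assms x in auto)
  moreover have "(x\<^sup>2) powr (p / 2) = x powr p"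
    using x by (simp add: powr_powr flip: powr_numeral)
  ultimately show ?thesis by simp
qed (use assms in simp)

text \<open>The same between \<open>x\<close> and 1 for the exponent \<open>p - 2\<close>,
  multiplied by \<open>x^2\<close>; this interpolates between the exponents 2 and 3.\<close>

lemma powr_le_mix_high:
  fixes x p :: real
  assumes "x \<ge> 0" "2 \<le> p" "p \<le> 3"
  shows "x powr p \<le> (3 - p) * x\<^sup>2 + (p - 2) * x ^ 3"
proof (cases "x = 0")
  case False
  then have x: "x > 0" using assms by simp
  have "x powr (p - 2) * 1 powr (3 - p) \<le> (p - 2) * x + (3 - p) * 1"
    by (rule Youngs_inequality_0) (use assms x in auto)
  then have "x\<^sup>2 * x powr (p - 2) \<le> x\<^sup>2 * ((p - 2) * x + (3 - p))"
    by (intro mult_left_mono) auto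
  moreover have "x\<^sup>2 * x powr (p - 2) = x powr p"
    using x by (simp add: powr_add[symmetric] flip: powr_numeral)
  ultimately show ?thesis by (simp add: power2_eq_square power3_eq_cube algebra_simps)
qed (use assms in simp)

text \<open>The claim amounts to \<open>\<integral>(l * \<bar>v\<bar>) powr p \<le> A\<close>. Below
  \<open>p = 2\<close> it is interpolated between the area and the second moment, above between the
  second and third moments.\<close>

lemma F_p_le_1:
  assumes \<Omega>: "open \<Omega>" "convex \<Omega>" "0 < emeasure lborel \<Omega>" "emeasure lborel \<Omega> < \<infinity>"
    and p: "1 \<le> p" "p \<le> 2.019"
  shows "F_p p \<Omega> \<le> 1"
proof -
  have S: "\<Omega> \<in> sets lborel" using \<Omega>(1) by simp
  have ne: "\<Omega> \<noteq> {}" using \<Omega>(3) by auto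
  define A where "A = measure lborel \<Omega>"
  have A: "A > 0" using \<Omega>(3,4) by (simp add: A_def measure_def enn2real_positive_iff)
  obtain n b W z where nW: "norm n = 1" "W > 0" "\<And>x. x \<in> \<Omega> \<Longrightarrow> \<bar>n \<bullet> x - b\<bar> \<le> W / 2" "ball z (W / 4) \<subseteq> \<Omega>"
    using convex_strip_and_ball[OF \<Omega>(1,2) convex_finite_measure_imp_bounded[OF \<Omega>(1,2,4)] ne] by metis
  note poinc = poincare_inequality[OF _ S \<Omega>(4) nW(1) nW(3)]
  obtain v g where tor: "torsion_sol \<Omega> v g"
    using torsion_exists[OF S \<Omega>(4) _ poinc] by auto
  define l where "l = lambda1 \<Omega>"
  define I where "I = (\<integral>x. \<bar>v x\<bar> powr p \<partial>lborel)"
  have I0: "I \<ge> 0" by (simp add: I_def)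
  have F: "F_p p \<Omega> = I powr (1 / p) * l / A powr (1 / p)"
  proof -
    have "torsion_Lp p \<Omega> = I powr (1 / p)"
      unfolding I_def by (rule torsion_Lp_eq[OF _ tor]) (rule poinc)
    then show ?thesis by (simp add: F_p_def l_def A_def)
  qed
  show ?thesis
  proof (cases "l > 0")
    \<comment> \<open>For nonpositive \<open>l\<close> the quantity itself is nonpositive.\<close>
    case False
    then have "I powr (1 / p) * l / A powr (1 / p) \<le> 0"
      by (intro divide_nonpos_nonneg mult_nonneg_nonpos) auto
    then show ?thesis using F by simp
  next
    case l: True
    define N where "N = (\<integral>x. (v x)\<^sup>2 \<partial>lborel)"
    have strip: "\<forall>x\<in>\<Omega>. \<bar>n \<bullet> x - b\<bar> \<le> W / 2" using nW(3) by blast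
    note tor_ineq = torsion_integral_inequalities[OF tor S \<Omega>(4) nW(1) strip, folded N_def A_def l_def]
    \<comment> \<open>A closed disc is required, so the radius is taken below \<open>W / 4\<close>;
      hence the constant \<open>25 * 20 / 3 = 500 / 3\<close>.\<close>
    have "lambda1 \<Omega> * (W / 5)\<^sup>2 \<le> 20 / 3"
      by (rule lambda1_le_ball[of _ z]) (use nW in \<open>auto simp: subset_iff\<close>)
    then have lW: "l * W\<^sup>2 \<le> 500 / 3" by (simp add: l_def power_divide)
    have deficit: "l\<^sup>2 * N \<le> (997/1000) * A"
      by (rule deficit_arithmetic[OF l A _ tor_ineq(1) tor_ineq(2) tor_ineq(3) lW]) (simp add: N_def)
    have vm [measurable]: "v \<in> borel_measurable lborel" using tor by (simp add: torsion_sol_def in_H01_def)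
    have "L2 lborel v" by (rule in_H01_E[OF torsion_sol_in_H01[OF tor]])
    then have i2: "integrable lborel (\<lambda>x. (v x)\<^sup>2)" using L2_integrable_norm by fastforce
    have scale: "(\<integral>x. (l * \<bar>v x\<bar>) powr p \<partial>lborel) = l powr p * I"
      unfolding I_def using l by (simp add: powr_mult)
    have main: "l powr p * I \<le> A"
    proof (cases "p \<le> 2")
      case True
      \<comment> \<open>The constant term may be restricted to \<open>\<Omega>\<close>, because
        \<open>v\<close> vanishes almost everywhere outside; this makes it integrable.\<close>
      have "(\<integral>x. (l * \<bar>v x\<bar>) powr p \<partial>lborel) \<le> (\<integral>x. (1 - p / 2) * indicator \<Omega> x + p / 2 * l\<^sup>2 * (v x)\<^sup>2 \<partial>lborel)"
      proof (rule integral_mono_AE')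
        show "integrable lborel (\<lambda>x. (1 - p / 2) * indicator \<Omega> x + p / 2 * l\<^sup>2 * (v x)\<^sup>2)"
          using i2 S \<Omega>(4) by simp
        show "AE x in lborel. (l * \<bar>v x\<bar>) powr p \<le> (1 - p / 2) * indicator \<Omega> x + p / 2 * l\<^sup>2 * (v x)\<^sup>2"
          using tor_ineq(4)
        proof eventually_elim
          case (elim x)
          show ?case
          proof (cases "x \<in> \<Omega>")
            case inside: True
            then show ?thesis
              using powr_le_mix_low[of "l * \<bar>v x\<bar>" p] l p True by (simp add: power_mult_distrib)
          qed (use elim p in simp)
        qed
        show "AE x in lborel. 0 \<le> (1 - p / 2) * indicator \<Omega> x + p / 2 * l\<^sup>2 * (v x)\<^sup>2"
          using True p by (intro AE_I2 add_nonneg_nonneg mult_nonneg_nonneg) auto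
      qed
      also have "\<dots> = (1 - p / 2) * A + p / 2 * (l\<^sup>2 * N)"
        using i2 S \<Omega>(4) by (simp add: A_def N_def)
      also have "\<dots> \<le> (1 - p / 2) * A + p / 2 * A"
        using deficit A p by (intro add_left_mono mult_left_mono) auto
      also have "\<dots> = A" by (simp add: algebra_simps)
      finally show ?thesis unfolding scale .
    next
      case False
      note L3 = torsion_L3_bound[OF tor l[unfolded l_def], folded l_def N_def]
      have "(\<integral>x. (l * \<bar>v x\<bar>) powr p \<partial>lborel) \<le>
          (\<integral>x. (3 - p) * l\<^sup>2 * (v x)\<^sup>2 + (p - 2) * l ^ 3 * \<bar>v x\<bar> ^ 3 \<partial>lborel)"
      proof (rule integral_mono_AE')
        show "integrable lborel (\<lambda>x. (3 - p) * l\<^sup>2 * (v x)\<^sup>2 + (p - 2) * l ^ 3 * \<bar>v x\<bar> ^ 3)"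
          using i2 L3(1) by simp
        show "AE x in lborel. (l * \<bar>v x\<bar>) powr p \<le> (3 - p) * l\<^sup>2 * (v x)\<^sup>2 + (p - 2) * l ^ 3 * \<bar>v x\<bar> ^ 3"
        proof (intro AE_I2)
          fix x
          show "(l * \<bar>v x\<bar>) powr p \<le> (3 - p) * l\<^sup>2 * (v x)\<^sup>2 + (p - 2) * l ^ 3 * \<bar>v x\<bar> ^ 3"
            using powr_le_mix_high[of "l * \<bar>v x\<bar>" p] l p False by (simp add: power_mult_distrib mult.assoc)
        qed
        show "AE x in lborel. 0 \<le> (3 - p) * l\<^sup>2 * (v x)\<^sup>2 + (p - 2) * l ^ 3 * \<bar>v x\<bar> ^ 3"
          using False p l by (intro AE_I2 add_nonneg_nonneg mult_nonneg_nonneg) auto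
      qed
      also have "\<dots> = (3 - p) * (l\<^sup>2 * N) + (p - 2) * (l\<^sup>2 * (l * (\<integral>x. \<bar>v x\<bar> ^ 3 \<partial>lborel)))"
        using i2 L3(1) by (simp add: N_def power3_eq_cube power2_eq_square mult.assoc)
      also have "\<dots> \<le> (3 - p) * (l\<^sup>2 * N) + (p - 2) * (l\<^sup>2 * (9/8 * N))"
        using L3(2) False by (intro add_left_mono mult_left_mono) auto
      also have "\<dots> = (1 + (p - 2) / 8) * (l\<^sup>2 * N)" by (simp add: field_simps)
      \<comment> \<open>The gain from the deficit outweighs the loss from the third moment:
        \<open>1.002375 * 0.997 < 0.9994\<close>.\<close>
      also have "\<dots> \<le> (1 + 0.019 / 8) * ((997/1000) * A)"
        by (rule mult_mono[OF _ deficit]) (use p in \<open>auto simp: N_def\<close>)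
      also have "\<dots> \<le> A" using A by simp
      finally show ?thesis unfolding scale .
    qed
    have "I powr (1 / p) * l = (l powr p * I) powr (1 / p)"
      using l I0 p by (simp add: powr_mult powr_powr)
    also have "\<dots> \<le> A powr (1 / p)"
      using main I0 p by (intro powr_mono2) auto
    finally show ?thesis using A F by (simp add: divide_le_eq_1)
  qed
qed

theorem theorem3:
  shows "p2_convex \<ge> ereal 2.0186 \<and> p2_convex \<ge> ereal (2 + 2 / sqrt 11559)"
proof -
  have "F_convex p \<le> 1" if "1 \<le> p" "p \<le> 2.019" for p
    unfolding F_convex_def by (rule Sup_least) (use F_p_le_1 that in auto)
  then have "p2_convex \<ge> ereal 2.019"
    unfolding p2_convex_def by (intro Inf_greatest) (force simp: not_le[symmetric])
  \<comment> \<open>The square of 107.5 is 11556.25, and \<open>2 / 107.5\<close> is below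
    0.019.\<close>
  moreover have "sqrt 11559 \<ge> 107.5"
    by (rule real_le_rsqrt) (simp add: power2_eq_square)
  then have "2 / sqrt 11559 \<le> 2 / 107.5"
    by (intro divide_left_mono) auto
  then have "ereal (2 + 2 / sqrt 11559) \<le> ereal 2.019" by simp
  moreover have "ereal 2.0186 \<le> ereal 2.019" by simp
  ultimately show ?thesis by (meson order_trans)
qed

end
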